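(* $\displaystyle\lim_{r\to+\infty}c(r)=\lambda_1^L$.
   Context: Let $N\ge 1$ be an integer and let $\Omega\subset\mathbb{R}^N$ be a bounded domain (open and connected) with $C^{1,1}$ boundary. $\|\cdot\|_2$ is the $L^2(\Omega)$ norm; $u^\pm=\max\{\pm u,0\}$. Put $c_N=\pi^{-N/2}\Gamma(N/2)$ and $\rho_N=2\ln 2+\psi(N/2)-\gamma$, with $\psi=\Gamma'/\Gamma$ the digamma function and $\gamma=-\Gamma'(1)$; $B_1$ is the unit ball centred at $0$, $k(z)=\mathbf 1_{B_1}(z)|z|^{-N}$, $j(z)=\mathbf 1_{\mathbb{R}^N\setminus B_1}(z)|z|^{-N}$ for $z\neq 0$. $\mathbb{H}(\Omega)$ is the Hilbert space of all $u\in L^2(\Omega)$, extended by $u=0$ in $\mathbb{R}^N\setminus\Omega$, with $\iint_{\mathbb{R}^{2N}}|u(x)-u(y)|^2k(x-y)\,dx\,dy<\infty$, with inner product $\mathcal{E}(u,v)=\frac{c_N}{2}\iint_{\mathbb{R}^{2N}}(u(x)-u(y))(v(x)-v(y))k(x-y)\,dx\,dy$ and norm $\|u\|=\mathcal{E}(u,u)^{1/2}$. The quadratic form of the logarithmic Laplacian is $$\mathcal{E}_L(u,v)=\mathcal{E}(u,v)-c_N\iint_{\mathbb{R}^{2N}}u(x)v(y)j(x-y)\,dx\,dy+\rho_N\int_{\mathbb{R}^N}uv\,dx .$$ The first eigenvalue is $\lambda_1^L=\min\{\mathcal{E}_L(u,u):u\in\mathbb{H}(\Omega),\|u\|_2=1\}$;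 it is simple, and $\varphi_1>0$ denotes the associated minimizer (eigenfunction) with $\|\varphi_1\|_2=1$. Let $\mathcal{P}=\{u\in\mathbb{H}(\Omega): \int_\Omega u^2\,dx=1\}$ (with the topology of $\mathbb{H}(\Omega)$), $E_r(u)=\mathcal{E}_L(u,u)-r\int_\Omega(u^+)^2\,dx$, $\Gamma=\{\gamma\in C([-1,1],\mathcal{P}):\gamma(-1)=-\varphi_1,\ \gamma(1)=\varphi_1\}$, and, for $r\ge 0$, $c(r)=\inf_{\gamma\in\Gamma}\max_{u\in\gamma[-1,1]}E_r(u)$. *)

theory Defs
  imports "HOL-Analysis.Analysis"
begin

text \<open>
  The gradient is globally Lipschitz. Below only the values of g near a point matter, so by a
  cut-off this gives the same class of domains as a gradient that is only locally Lipschitz.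
\<close>
definition C11_function :: "('a::euclidean_space \<Rightarrow> real) \<Rightarrow> bool" where
  "C11_function g \<longleftrightarrow>
     (\<exists>G L. (\<forall>x. GDERIV g x :> G x) \<and> L-lipschitz_on UNIV G)"

text \<open>
  Near each boundary point the domain is the strict epigraph, in some direction e, of a function
  of class C^{1,1} on the hyperplane orthogonal to e. A function on that hyperplane is represented
  by a function on the whole space that is evaluated at orthogonal projections only.
  In dimension 1 the hyperplane is {0}, and the condition says that near each boundary point the
  set is a one-sided interval.
\<close>
definition C11_boundary :: "'a::euclidean_space set \<Rightarrow> bool" where
  "C11_boundary \<Omega> \<longleftrightarrow>
     (\<forall>p\<in>frontier \<Omega>. \<exists>e g \<delta>. norm e = 1 \<and> \<delta> > 0 \<and> C11_function g \<and>
        \<Omega> \<inter> ball p \<delta> = {x \<in> ball p \<delta>. g (x - (x \<bullet> e) *\<^sub>R e) < x \<bullet> e})"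

definition c_const :: "'a::euclidean_space itself \<Rightarrow> real" where
  "c_const _ = pi powr (- real DIM('a) / 2) * Gamma (real DIM('a) / 2)"

definition rho_const :: "'a::euclidean_space itself \<Rightarrow> real" where
  "rho_const _ = 2 * ln 2 + Digamma (real DIM('a) / 2) - euler_mascheroni"

text \<open>Both kernels take the (irrelevant) value 0 at the origin.\<close>
definition k_kernel :: "'a::euclidean_space \<Rightarrow> real" where
  "k_kernel z = indicator (ball 0 1) z / norm z ^ DIM('a)"

definition j_kernel :: "'a::euclidean_space \<Rightarrow> real" where
  "j_kernel z = indicator (- ball 0 1) z / norm z ^ DIM('a)"

text \<open>
  Elements of the Hilbert space are represented by Borel functions vanishing outside the domain;
  two representatives of the same element agree almost everywhere. All notions below are
  invariant under changing representatives.
\<close>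
definition H_space :: "'a::euclidean_space set \<Rightarrow> ('a \<Rightarrow> real) set" where
  "H_space \<Omega> = {u. u \<in> borel_measurable borel \<and> (\<forall>x. x \<notin> \<Omega> \<longrightarrow> u x = 0) \<and>
     integrable lborel (\<lambda>x. (u x)\<^sup>2) \<and>
     integrable (lborel \<Otimes>\<^sub>M lborel) (\<lambda>(x, y). \<bar>u x - u y\<bar>\<^sup>2 * k_kernel (x - y))}"

definition E_form :: "('a::euclidean_space \<Rightarrow> real) \<Rightarrow> ('a \<Rightarrow> real) \<Rightarrow> real" where
  "E_form u v = c_const TYPE('a) / 2 *
     (LINT (x, y)|(lborel \<Otimes>\<^sub>M lborel). (u x - u y) * (v x - v y) * k_kernel (x - y))"

definition H_norm :: "('a::euclidean_space \<Rightarrow> real) \<Rightarrow> real" where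
  "H_norm u = sqrt (E_form u u)"

definition EL_form :: "('a::euclidean_space \<Rightarrow> real) \<Rightarrow> ('a \<Rightarrow> real) \<Rightarrow> real" where
  "EL_form u v = E_form u v
     - c_const TYPE('a) * (LINT (x, y)|(lborel \<Otimes>\<^sub>M lborel). u x * v y * j_kernel (x - y))
     + rho_const TYPE('a) * (LINT x|lborel. u x * v x)"

definition L2_sphere :: "'a::euclidean_space set \<Rightarrow> ('a \<Rightarrow> real) set" where
  "L2_sphere \<Omega> = {u \<in> H_space \<Omega>. (LINT x:\<Omega>|lborel. (u x)\<^sup>2) = 1}"

definition first_eigenvalue :: "'a::euclidean_space set \<Rightarrow> real" where
  "first_eigenvalue \<Omega> = (INF u\<in>L2_sphere \<Omega>. EL_form u u)"

definition first_eigenfunction :: "'a::euclidean_space set \<Rightarrow> ('a \<Rightarrow> real) \<Rightarrow> bool" where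
  "first_eigenfunction \<Omega> \<phi> \<longleftrightarrow>
     is_arg_min (\<lambda>u. EL_form u u) (\<lambda>u. u \<in> L2_sphere \<Omega>) \<phi> \<and>
     (AE x in lborel. x \<in> \<Omega> \<longrightarrow> \<phi> x > 0)"

definition E_functional :: "'a::euclidean_space set \<Rightarrow> real \<Rightarrow> ('a \<Rightarrow> real) \<Rightarrow> real" where
  "E_functional \<Omega> r u = EL_form u u - r * (LINT x:\<Omega>|lborel. (max (u x) 0)\<^sup>2)"

text \<open>
  Paths in the sphere, continuous for the norm of the Hilbert space. As elements of that space are
  classes of functions, the end points are prescribed almost everywhere.
\<close>
definition admissible_paths ::
    "'a::euclidean_space set \<Rightarrow> ('a \<Rightarrow> real) \<Rightarrow> (real \<Rightarrow> 'a \<Rightarrow> real) set" where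
  "admissible_paths \<Omega> \<phi> = {\<gamma>. (\<forall>t\<in>{-1..1}. \<gamma> t \<in> L2_sphere \<Omega>) \<and>
     (\<forall>t\<in>{-1..1}. ((\<lambda>s. H_norm (\<lambda>x. \<gamma> s x - \<gamma> t x)) \<longlongrightarrow> 0) (at t within {-1..1})) \<and>
     (AE x in lborel. \<gamma> (-1) x = - \<phi> x) \<and> (AE x in lborel. \<gamma> 1 x = \<phi> x)}"

text \<open>The supremum is a maximum, as the functional is continuous along admissible paths.\<close>
definition minimax_level :: "'a::euclidean_space set \<Rightarrow> ('a \<Rightarrow> real) \<Rightarrow> real \<Rightarrow> real" where
  "minimax_level \<Omega> \<phi> r =
     (INF \<gamma>\<in>admissible_paths \<Omega> \<phi>. SUP t\<in>{-1..1}. E_functional \<Omega> r (\<gamma> t))"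

end

theory Submission imports Defs begin

text \<open>
  Write \<open>\<lambda>\<close> for the first eigenvalue, \<open>\<phi>\<close> for the eigenfunction and
  Q(u) = \<open>EL_form u u - \<lambda> L2_form u u\<close>.

  The level is at least \<open>\<lambda>\<close> because every path starts at \<open>-\<phi>\<close>, where the positive part vanishes
  (\<open>first_eigenvalue_le_path_sup\<close>). Hence it suffices to find, for each \<open>\<epsilon>\<close>, one path along which
  the functional is at most \<open>\<lambda> + \<epsilon>\<close> for all large r (\<open>exists_low_path\<close>).

  Such a path must leave \<open>-\<phi>\<close> without paying much energy, and must have a positive part of definite
  size as soon as it has left the vicinity of \<open>-\<phi>\<close>, since the term with r then pulls the functional
  down. This is possible because points have zero capacity for the energy: a tent b of height 1 on a
  small ball has arbitrarily small energy and square norm (\<open>tent_forms_small\<close>). It is placed at a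
  point around which \<open>\<phi>\<close> is below a fixed constant A on sets of positive measure
  (\<open>exists_slab_of_positive_measure\<close>, \<open>exists_support_point\<close>). The path is the normalisation of
  t \<open>\<phi>\<close> + (1 - |t|) b.

  The computation is exact: Q is nonnegative and vanishes at \<open>\<phi>\<close>, so \<open>\<phi>\<close> is in its radical, and Q
  takes the value (1 - |t|)^2 Q(b) at the point t before normalisation (\<open>spectral_gap_lincomb\<close>). As
  long as the coefficient of b is below 4A|t| with t negative, this is small compared with the square
  norm, because Q(b) is small compared with 1/A^2. From then on the function exceeds a quarter of
  that coefficient on a fixed set of positive measure, and a large r makes the functional at most \<open>\<lambda>\<close>
  (\<open>low_level_estimate\<close>).
\<close>

section \<open>The bilinear forms on the Hilbert space\<close>

definition L2_form :: "('a::euclidean_space \<Rightarrow> real) \<Rightarrow> ('a \<Rightarrow> real) \<Rightarrow> real" where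
  "L2_form u v = (LINT x|lborel. u x * v x)"

text \<open>
  The term of the logarithmic Laplacian that couples points at distance at least 1. Its
  symmetry is not immediate from the definition, so the expansion of the form below keeps the two
  mixed terms apart; only their sum matters.
\<close>
definition tail_form :: "('a::euclidean_space \<Rightarrow> real) \<Rightarrow> ('a \<Rightarrow> real) \<Rightarrow> real" where
  "tail_form u v = (LINT (x, y)|(lborel \<Otimes>\<^sub>M lborel). u x * v y * j_kernel (x - y))"

lemma EL_form_alt:
  fixes u v :: "'a::euclidean_space \<Rightarrow> real"
  shows "EL_form u v = E_form u v - c_const TYPE('a) * tail_form u v + rho_const TYPE('a) * L2_form u v"
  unfolding EL_form_def tail_form_def L2_form_def by simp

lemma c_const_nonneg: "c_const TYPE('a::euclidean_space) \<ge> 0"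
  unfolding c_const_def by (intro mult_nonneg_nonneg) (auto intro!: less_imp_le Gamma_real_pos)

lemma k_kernel_measurable [measurable]: "k_kernel \<in> borel_measurable (borel :: 'a::euclidean_space measure)"
  unfolding k_kernel_def
  by (intro borel_measurable_divide borel_measurable_indicator borel_measurable_power borel_measurable_norm) auto

lemma j_kernel_measurable [measurable]: "j_kernel \<in> borel_measurable (borel :: 'a::euclidean_space measure)"
  unfolding j_kernel_def
  by (intro borel_measurable_divide borel_measurable_indicator borel_measurable_power borel_measurable_norm) auto

lemma k_kernel_nonneg: "k_kernel z \<ge> 0"
  unfolding k_kernel_def by simp

lemma j_kernel_nonneg: "j_kernel z \<ge> 0"
  unfolding j_kernel_def by simp

lemma j_kernel_le_1: "j_kernel z \<le> 1"
proof (cases "z \<in> ball 0 1")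
  case False
  then have "1 \<le> norm z ^ DIM('a)" by simp
  then show ?thesis by (auto simp: j_kernel_def indicator_def divide_simps)
qed (simp add: j_kernel_def)

lemma k_kernel_commute: "k_kernel (x - y) = k_kernel (y - x)"
  unfolding k_kernel_def by (simp add: indicator_def norm_minus_commute)

lemma L2_form_commute: "L2_form u v = L2_form v u"
  unfolding L2_form_def by (simp add: mult.commute)

lemma E_form_commute: "E_form u v = E_form v u"
  unfolding E_form_def by (simp add: mult.commute)

lemma L2_form_self_nonneg: "L2_form u u \<ge> 0"
  unfolding L2_form_def by (intro Bochner_Integration.integral_nonneg) auto

lemma E_form_self_nonneg: "E_form u u \<ge> 0"
  unfolding E_form_def
  by (intro mult_nonneg_nonneg Bochner_Integration.integral_nonneg) (auto simp: c_const_nonneg k_kernel_nonneg)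

lemma H_space_measurable: "u \<in> H_space \<Omega> \<Longrightarrow> u \<in> borel_measurable borel"
  unfolding H_space_def by simp

lemma H_space_outside: "u \<in> H_space \<Omega> \<Longrightarrow> x \<notin> \<Omega> \<Longrightarrow> u x = 0"
  unfolding H_space_def by simp

text \<open>
  Gives integrability of products from that of squares.
\<close>
lemma abs_mult_le_sum_squares: "\<bar>a * b\<bar> \<le> a\<^sup>2 + (b::real)\<^sup>2"
proof -
  have "0 \<le> (\<bar>a\<bar> - \<bar>b\<bar>)\<^sup>2" by simp
  moreover have "(\<bar>a\<bar> - \<bar>b\<bar>)\<^sup>2 = a\<^sup>2 - 2 * \<bar>a * b\<bar> + b\<^sup>2"
    by (simp add: power2_diff abs_mult)
  ultimately show ?thesis by (smt (verit) zero_le_power2)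
qed

lemma H_space_integrable_mult:
  assumes "u \<in> H_space \<Omega>" "v \<in> H_space \<Omega>"
  shows "integrable lborel (\<lambda>x. u x * v x)"
proof (rule Bochner_Integration.integrable_bound)
  show "integrable lborel (\<lambda>x. (u x)\<^sup>2 + (v x)\<^sup>2)"
    using assms by (auto simp: H_space_def)
  have [measurable]: "u \<in> borel_measurable borel" "v \<in> borel_measurable borel"
    using assms by (auto simp: H_space_def)
  show "(\<lambda>x. u x * v x) \<in> borel_measurable lborel" by measurable
  show "AE x in lborel. norm (u x * v x) \<le> norm ((u x)\<^sup>2 + (v x)\<^sup>2)"
    using abs_mult_le_sum_squares by (intro AE_I2) auto
qed

text \<open>
  The Bochner integral of a function that is not integrable is 0, so the algebra of the three
  forms rests on integrability of each of their integrands.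
\<close>
lemma H_space_integrable_E:
  fixes u v :: "'a::euclidean_space \<Rightarrow> real"
  assumes "u \<in> H_space \<Omega>" "v \<in> H_space \<Omega>"
  shows "integrable (lborel \<Otimes>\<^sub>M lborel) (\<lambda>(x, y). (u x - u y) * (v x - v y) * k_kernel (x - y))"
proof (rule Bochner_Integration.integrable_bound)
  have "integrable (lborel \<Otimes>\<^sub>M lborel) (\<lambda>z. (\<lambda>(x, y). \<bar>u x - u y\<bar>\<^sup>2 * k_kernel (x - y)) z + (\<lambda>(x, y). \<bar>v x - v y\<bar>\<^sup>2 * k_kernel (x - y)) z)"
    using assms unfolding H_space_def by (intro Bochner_Integration.integrable_add) blast+
  then show "integrable (lborel \<Otimes>\<^sub>M lborel) (\<lambda>(x, y). ((u x - u y)\<^sup>2 + (v x - v y)\<^sup>2) * k_kernel (x - y))"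
    by (rule back_subst[where P = "integrable (lborel \<Otimes>\<^sub>M lborel)"])
       (auto simp: fun_eq_iff algebra_simps)
  have [measurable]: "u \<in> borel_measurable borel" "v \<in> borel_measurable borel"
    using assms by (auto simp: H_space_def)
  show "(\<lambda>(x, y). (u x - u y) * (v x - v y) * k_kernel (x - y)) \<in> borel_measurable (lborel \<Otimes>\<^sub>M lborel)"
    by measurable
  show "AE z in lborel \<Otimes>\<^sub>M lborel. norm ((\<lambda>(x, y). (u x - u y) * (v x - v y) * k_kernel (x - y)) z)
      \<le> norm ((\<lambda>(x, y). ((u x - u y)\<^sup>2 + (v x - v y)\<^sup>2) * k_kernel (x - y)) z)"
    using abs_mult_le_sum_squares k_kernel_nonneg
    by (intro AE_I2) (auto simp: abs_mult[of _ "k_kernel _"] intro!: mult_right_mono split: prod.splits)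
qed

text \<open>
  The absolute value of a number is at most 1 plus its square, and the domain has finite measure.
\<close>
lemma H_space_integrable:
  assumes "bounded \<Omega>" "open \<Omega>" "u \<in> H_space \<Omega>"
  shows "integrable lborel u"
proof (rule Bochner_Integration.integrable_bound)
  have "emeasure lborel \<Omega> < \<infinity>" by (rule emeasure_bounded_finite[OF assms(1)])
  then show "integrable lborel (\<lambda>x. indicator \<Omega> x + (u x)\<^sup>2)"
    using assms by (auto simp: H_space_def)
  show "u \<in> borel_measurable lborel"
    using assms by (auto simp: H_space_def)
  have "norm (u x) \<le> norm (indicator \<Omega> x + (u x)\<^sup>2)" for x
    using abs_mult_le_sum_squares[of "u x" 1] H_space_outside[OF assms(3), of x]
    by (cases "x \<in> \<Omega>") auto
  then show "AE x in lborel. norm (u x) \<le> norm (indicator \<Omega> x + (u x)\<^sup>2)"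
    by simp
qed

text \<open>
  Used to dominate the integrand of the tail form, whose kernel is bounded by 1.
\<close>
lemma lborel_product_of_functions:
  fixes f :: "'a::euclidean_space \<Rightarrow> real" and g :: "'b::euclidean_space \<Rightarrow> real"
  assumes "integrable lborel f" "integrable lborel g"
  shows "integrable (lborel \<Otimes>\<^sub>M lborel) (\<lambda>(x, y). f x * g y)"
    and "(LINT (x, y)|(lborel \<Otimes>\<^sub>M lborel). f x * g y) = (LINT x|lborel. f x) * (LINT y|lborel. g y)"
proof -
  have [measurable]: "f \<in> borel_measurable borel" "g \<in> borel_measurable borel"
    using assms by (auto dest: borel_measurable_integrable)
  have "integrable (lborel \<Otimes>\<^sub>M lborel) (\<lambda>z. f (fst z) * g (snd z))"
    using assms by (intro lborel_pair.Fubini_integrable) (auto simp: abs_mult)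
  then show i: "integrable (lborel \<Otimes>\<^sub>M lborel) (\<lambda>(x, y). f x * g y)"
    by (simp add: split_beta')
  from lborel_pair.integral_fst'[OF i]
  show "(LINT (x, y)|(lborel \<Otimes>\<^sub>M lborel). f x * g y) = (LINT x|lborel. f x) * (LINT y|lborel. g y)"
    by simp
qed

lemma H_space_integrable_tail:
  fixes u v :: "'a::euclidean_space \<Rightarrow> real"
  assumes "bounded \<Omega>" "open \<Omega>" "u \<in> H_space \<Omega>" "v \<in> H_space \<Omega>"
  shows "integrable (lborel \<Otimes>\<^sub>M lborel) (\<lambda>(x, y). u x * v y * j_kernel (x - y))"
proof (rule Bochner_Integration.integrable_bound)
  show "integrable (lborel \<Otimes>\<^sub>M lborel) (\<lambda>(x, y). u x * v y)"
    by (intro lborel_product_of_functions(1) H_space_integrable[OF assms(1,2)] assms)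
  have [measurable]: "u \<in> borel_measurable borel" "v \<in> borel_measurable borel"
    using assms by (auto simp: H_space_def)
  show "(\<lambda>(x, y). u x * v y * j_kernel (x - y)) \<in> borel_measurable (lborel \<Otimes>\<^sub>M lborel)"
    by measurable
  show "AE z in lborel \<Otimes>\<^sub>M lborel. norm ((\<lambda>(x, y). u x * v y * j_kernel (x - y)) z)
      \<le> norm ((\<lambda>(x, y). u x * v y) z)"
    by (intro AE_I2) (auto simp: abs_mult j_kernel_nonneg j_kernel_le_1 intro!: mult_left_le split: prod.splits)
qed

lemma H_space_lincomb:
  fixes u v :: "'a::euclidean_space \<Rightarrow> real"
  assumes "u \<in> H_space \<Omega>" "v \<in> H_space \<Omega>"
  shows "(\<lambda>x. a * u x + b * v x) \<in> H_space \<Omega>"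
proof -
  have [measurable]: "u \<in> borel_measurable borel" "v \<in> borel_measurable borel"
    using assms by (auto simp: H_space_def)
  have "integrable lborel (\<lambda>x. a\<^sup>2 * (u x * u x) + (2 * a * b) * (u x * v x) + b\<^sup>2 * (v x * v x))"
    by (intro Bochner_Integration.integrable_add Bochner_Integration.integrable_mult_right
          H_space_integrable_mult[OF assms(1) assms(1)] H_space_integrable_mult[OF assms]
          H_space_integrable_mult[OF assms(2) assms(2)])
  then have 1: "integrable lborel (\<lambda>x. (a * u x + b * v x)\<^sup>2)"
    by (rule back_subst[where P = "integrable lborel"]) (auto simp: fun_eq_iff power2_eq_square algebra_simps)
  have "integrable (lborel \<Otimes>\<^sub>M lborel) (\<lambda>z.
      a\<^sup>2 * (\<lambda>(x, y). (u x - u y) * (u x - u y) * k_kernel (x - y)) z +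
      (2 * a * b) * (\<lambda>(x, y). (u x - u y) * (v x - v y) * k_kernel (x - y)) z +
      b\<^sup>2 * (\<lambda>(x, y). (v x - v y) * (v x - v y) * k_kernel (x - y)) z)"
    by (intro Bochner_Integration.integrable_add Bochner_Integration.integrable_mult_right
          H_space_integrable_E[OF assms(1) assms(1)] H_space_integrable_E[OF assms]
          H_space_integrable_E[OF assms(2) assms(2)])
  then have 2: "integrable (lborel \<Otimes>\<^sub>M lborel)
      (\<lambda>(x, y). \<bar>(a * u x + b * v x) - (a * u y + b * v y)\<bar>\<^sup>2 * k_kernel (x - y))"
    by (rule back_subst[where P = "integrable (lborel \<Otimes>\<^sub>M lborel)"])
       (auto simp: fun_eq_iff power2_eq_square algebra_simps)
  show ?thesis
    using 1 2 assms by (auto simp: H_space_def)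
qed

lemma L2_form_lincomb:
  assumes "u \<in> H_space \<Omega>" "v \<in> H_space \<Omega>"
  shows "L2_form (\<lambda>x. a * u x + b * v x) (\<lambda>x. a * u x + b * v x) =
    a\<^sup>2 * L2_form u u + 2 * a * b * L2_form u v + b\<^sup>2 * L2_form v v"
proof -
  note i = H_space_integrable_mult[OF assms(1) assms(1)] H_space_integrable_mult[OF assms]
          H_space_integrable_mult[OF assms(2) assms(2)]
  have "a\<^sup>2 * L2_form u u + 2 * a * b * L2_form u v + b\<^sup>2 * L2_form v v =
     (LINT x|lborel. a\<^sup>2 * (u x * u x) + (2 * a * b) * (u x * v x) + b\<^sup>2 * (v x * v x))"
    unfolding L2_form_def using i by simp
  also have "\<dots> = L2_form (\<lambda>x. a * u x + b * v x) (\<lambda>x. a * u x + b * v x)"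
    unfolding L2_form_def by (intro Bochner_Integration.integral_cong) (auto simp: power2_eq_square algebra_simps)
  finally show ?thesis by simp
qed

lemma E_form_lincomb:
  fixes u v :: "'a::euclidean_space \<Rightarrow> real"
  assumes "u \<in> H_space \<Omega>" "v \<in> H_space \<Omega>"
  shows "E_form (\<lambda>x. a * u x + b * v x) (\<lambda>x. a * u x + b * v x) =
    a\<^sup>2 * E_form u u + 2 * a * b * E_form u v + b\<^sup>2 * E_form v v"
proof -
  define I where "I u v = (LINT (x, y)|(lborel \<Otimes>\<^sub>M lborel). (u x - u y) * (v x - v y) * k_kernel (x - y))"
    for u v :: "'a \<Rightarrow> real"
  note i = H_space_integrable_E[OF assms(1) assms(1)] H_space_integrable_E[OF assms]
          H_space_integrable_E[OF assms(2) assms(2)]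
  have "a\<^sup>2 * I u u + 2 * a * b * I u v + b\<^sup>2 * I v v =
     (LINT z|(lborel \<Otimes>\<^sub>M lborel).
       a\<^sup>2 * (\<lambda>(x, y). (u x - u y) * (u x - u y) * k_kernel (x - y)) z +
      (2 * a * b) * (\<lambda>(x, y). (u x - u y) * (v x - v y) * k_kernel (x - y)) z +
      b\<^sup>2 * (\<lambda>(x, y). (v x - v y) * (v x - v y) * k_kernel (x - y)) z)"
    unfolding I_def using i by simp
  also have "\<dots> = I (\<lambda>x. a * u x + b * v x) (\<lambda>x. a * u x + b * v x)"
    unfolding I_def by (intro Bochner_Integration.integral_cong) (auto simp: power2_eq_square algebra_simps)
  finally have "I (\<lambda>x. a * u x + b * v x) (\<lambda>x. a * u x + b * v x) =
      a\<^sup>2 * I u u + 2 * a * b * I u v + b\<^sup>2 * I v v" ..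
  then show ?thesis
    unfolding E_form_def I_def[symmetric] by (simp add: field_simps)
qed

lemma tail_form_lincomb:
  fixes u v :: "'a::euclidean_space \<Rightarrow> real"
  assumes "bounded \<Omega>" "open \<Omega>" "u \<in> H_space \<Omega>" "v \<in> H_space \<Omega>"
  shows "tail_form (\<lambda>x. a * u x + b * v x) (\<lambda>x. a * u x + b * v x) =
    a\<^sup>2 * tail_form u u + a * b * (tail_form u v + tail_form v u) + b\<^sup>2 * tail_form v v"
proof -
  note i = H_space_integrable_tail[OF assms(1,2) assms(3) assms(3)] H_space_integrable_tail[OF assms]
          H_space_integrable_tail[OF assms(1,2) assms(4) assms(3)] H_space_integrable_tail[OF assms(1,2) assms(4) assms(4)]
  have "a\<^sup>2 * tail_form u u + a * b * tail_form u v + a * b * tail_form v u + b\<^sup>2 * tail_form v v =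
     (LINT z|(lborel \<Otimes>\<^sub>M lborel).
       a\<^sup>2 * (\<lambda>(x, y). u x * u y * j_kernel (x - y)) z +
      (a * b) * (\<lambda>(x, y). u x * v y * j_kernel (x - y)) z +
      (a * b) * (\<lambda>(x, y). v x * u y * j_kernel (x - y)) z +
      b\<^sup>2 * (\<lambda>(x, y). v x * v y * j_kernel (x - y)) z)"
    unfolding tail_form_def using i by simp
  also have "\<dots> = tail_form (\<lambda>x. a * u x + b * v x) (\<lambda>x. a * u x + b * v x)"
    unfolding tail_form_def by (intro Bochner_Integration.integral_cong) (auto simp: power2_eq_square algebra_simps)
  finally show ?thesis by (simp add: algebra_simps)
qed

text \<open>
  The kernel is at most 1, and half the sum of two squares dominates a product. This makes the
  tail form a bounded perturbation in the square norm alone: the logarithmic Laplacian differs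
  from the energy by at most a constant multiple of the square of the norm.
\<close>
lemma abs_tail_form_le:
  fixes u :: "'a::euclidean_space \<Rightarrow> real"
  assumes "bounded \<Omega>" "open \<Omega>" "u \<in> H_space \<Omega>"
  shows "\<bar>tail_form u u\<bar> \<le> measure lborel \<Omega> * L2_form u u"
proof -
  have fin: "emeasure lborel \<Omega> < \<infinity>" by (rule emeasure_bounded_finite[OF assms(1)])
  have meas: "\<Omega> \<in> sets lborel" using assms(2) by simp
  have iu: "integrable lborel (\<lambda>x. u x * u x)" by (rule H_space_integrable_mult[OF assms(3) assms(3)])
  have ii: "integrable lborel (indicator \<Omega> :: 'a \<Rightarrow> real)" using fin meas by simp
  have i1: "integrable (lborel \<Otimes>\<^sub>M lborel) (\<lambda>(x, y). (u x * u x) * indicator \<Omega> y)"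
    by (rule lborel_product_of_functions(1)[OF iu ii])
  have i2: "integrable (lborel \<Otimes>\<^sub>M lborel) (\<lambda>(x, y). indicator \<Omega> x * (u y * u y))"
    by (rule lborel_product_of_functions(1)[OF ii iu])
  \<comment> \<open>Off the domain both sides vanish, which brings in the indicators and hence a finite integral.\<close>
  have pt: "\<bar>u x * u y * j_kernel (x - y)\<bar> \<le> (u x * u x * indicator \<Omega> y) / 2 + (indicator \<Omega> x * (u y * u y)) / 2" for x y
  proof (cases "x \<in> \<Omega> \<and> y \<in> \<Omega>")
    case True
    have "0 \<le> (\<bar>u x\<bar> - \<bar>u y\<bar>)\<^sup>2" by simp
    then have "\<bar>u x\<bar> * \<bar>u y\<bar> \<le> (u x * u x) / 2 + (u y * u y) / 2"
      by (simp add: power2_eq_square algebra_simps)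
    moreover have "\<bar>u x * u y * j_kernel (x - y)\<bar> \<le> \<bar>u x\<bar> * \<bar>u y\<bar>"
      using j_kernel_nonneg[of "x - y"] j_kernel_le_1[of "x - y"] by (simp add: abs_mult mult_left_le)
    ultimately show ?thesis using True by simp
  next
    case False
    then show ?thesis using H_space_outside[OF assms(3)] by (auto simp: indicator_def)
  qed
  have "\<bar>tail_form u u\<bar> \<le> (LINT z|(lborel \<Otimes>\<^sub>M lborel). \<bar>(\<lambda>(x, y). u x * u y * j_kernel (x - y)) z\<bar>)"
    unfolding tail_form_def by (rule integral_abs_bound)
  also have "\<dots> \<le> (LINT z|(lborel \<Otimes>\<^sub>M lborel). (\<lambda>(x, y). (u x * u x) * indicator \<Omega> y) z / 2 + (\<lambda>(x, y). indicator \<Omega> x * (u y * u y)) z / 2)"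
    using i1 i2 by (intro integral_mono integrable_abs H_space_integrable_tail[OF assms(1,2,3,3)]) (auto simp: pt)
  also have "\<dots> = (LINT z|(lborel \<Otimes>\<^sub>M lborel). (\<lambda>(x, y). (u x * u x) * indicator \<Omega> y) z) / 2 + (LINT z|(lborel \<Otimes>\<^sub>M lborel). (\<lambda>(x, y). indicator \<Omega> x * (u y * u y)) z) / 2"
    using i1 i2 by simp
  also have "\<dots> = measure lborel \<Omega> * L2_form u u"
    using lborel_product_of_functions(2)[OF iu ii] lborel_product_of_functions(2)[OF ii iu] meas fin
    by (simp add: L2_form_def)
  finally show ?thesis .
qed

section \<open>The first eigenvalue as a minimum of a quadratic form\<close>

lemma L2_sphere_iff: "u \<in> L2_sphere \<Omega> \<longleftrightarrow> u \<in> H_space \<Omega> \<and> L2_form u u = 1"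
proof -
  have "(LINT x:\<Omega>|lborel. (u x)\<^sup>2) = L2_form u u" if "u \<in> H_space \<Omega>"
    unfolding L2_form_def set_lebesgue_integral_def
    by (intro Bochner_Integration.integral_cong)
       (use H_space_outside[OF that] in \<open>auto simp: indicator_def power2_eq_square\<close>)
  then show ?thesis unfolding L2_sphere_def by auto
qed

lemma EL_form_lincomb:
  assumes "bounded \<Omega>" "open \<Omega>" "u \<in> H_space \<Omega>" "v \<in> H_space \<Omega>"
  shows "EL_form (\<lambda>x. a * u x + b * v x) (\<lambda>x. a * u x + b * v x) =
    a\<^sup>2 * EL_form u u + a * b * (EL_form u v + EL_form v u) + b\<^sup>2 * EL_form v v"
  unfolding EL_form_alt E_form_lincomb[OF assms(3,4)] tail_form_lincomb[OF assms]
    L2_form_lincomb[OF assms(3,4)] E_form_commute[of v u] L2_form_commute[of v u]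
  by (simp add: algebra_simps)

lemma H_space_scale: "u \<in> H_space \<Omega> \<Longrightarrow> (\<lambda>x. a * u x) \<in> H_space \<Omega>"
  using H_space_lincomb[of u \<Omega> u a 0] by simp

lemma L2_form_scale: "u \<in> H_space \<Omega> \<Longrightarrow> L2_form (\<lambda>x. a * u x) (\<lambda>x. a * u x) = a\<^sup>2 * L2_form u u"
  using L2_form_lincomb[of u \<Omega> u a 0] by simp

lemma EL_form_scale:
  assumes "bounded \<Omega>" "open \<Omega>" "u \<in> H_space \<Omega>"
  shows "EL_form (\<lambda>x. a * u x) (\<lambda>x. a * u x) = a\<^sup>2 * EL_form u u"
  using EL_form_lincomb[OF assms assms(3), of a 0] by simp

lemma abs_EL_form_minus_E_form_le:
  fixes u :: "'a::euclidean_space \<Rightarrow> real"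
  assumes "bounded \<Omega>" "open \<Omega>" "u \<in> H_space \<Omega>"
  shows "\<bar>EL_form u u - E_form u u\<bar>
    \<le> (c_const TYPE('a) * measure lborel \<Omega> + \<bar>rho_const TYPE('a)\<bar>) * L2_form u u"
proof -
  have "\<bar>EL_form u u - E_form u u\<bar> \<le> c_const TYPE('a) * \<bar>tail_form u u\<bar> + \<bar>rho_const TYPE('a)\<bar> * L2_form u u"
  proof -
    have "EL_form u u - E_form u u = rho_const TYPE('a) * L2_form u u - c_const TYPE('a) * tail_form u u"
      unfolding EL_form_alt by simp
    also have "\<bar>\<dots>\<bar> \<le> \<bar>rho_const TYPE('a) * L2_form u u\<bar> + \<bar>c_const TYPE('a) * tail_form u u\<bar>"
      by (rule abs_triangle_ineq4)
    finally show ?thesis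
      using c_const_nonneg[where 'a = 'a] L2_form_self_nonneg[of u] by (simp add: abs_mult)
  qed
  also have "\<dots> \<le> c_const TYPE('a) * (measure lborel \<Omega> * L2_form u u) + \<bar>rho_const TYPE('a)\<bar> * L2_form u u"
    using abs_tail_form_le[OF assms] c_const_nonneg[where 'a = 'a] by (intro add_mono mult_left_mono) auto
  finally show ?thesis by (simp add: algebra_simps)
qed

lemma first_eigenfunctionD:
  assumes "first_eigenfunction \<Omega> \<phi>"
  shows "\<phi> \<in> H_space \<Omega>" "L2_form \<phi> \<phi> = 1" "AE x in lborel. x \<in> \<Omega> \<longrightarrow> \<phi> x > 0"
    and "first_eigenvalue \<Omega> = EL_form \<phi> \<phi>"
    and "\<And>u. u \<in> L2_sphere \<Omega> \<Longrightarrow> EL_form \<phi> \<phi> \<le> EL_form u u"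
proof -
  have \<phi>: "\<phi> \<in> L2_sphere \<Omega>" and
    min: "\<And>u. u \<in> L2_sphere \<Omega> \<Longrightarrow> EL_form \<phi> \<phi> \<le> EL_form u u"
    using assms unfolding first_eigenfunction_def is_arg_min_def by (auto simp: not_less)
  then show "\<phi> \<in> H_space \<Omega>" "L2_form \<phi> \<phi> = 1"
    and "\<And>u. u \<in> L2_sphere \<Omega> \<Longrightarrow> EL_form \<phi> \<phi> \<le> EL_form u u" by (auto simp: L2_sphere_iff)
  show "AE x in lborel. x \<in> \<Omega> \<longrightarrow> \<phi> x > 0"
    using assms unfolding first_eigenfunction_def by auto
  show "first_eigenvalue \<Omega> = EL_form \<phi> \<phi>"
    unfolding first_eigenvalue_def using \<phi> min by (intro cInf_eq_minimum) auto
qed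

text \<open>
  Homogeneity gives this away from functions of norm 0. For those the tail form vanishes with the
  norm, and the energy is nonnegative.
\<close>
lemma first_eigenvalue_le_Rayleigh:
  fixes u :: "'a::euclidean_space \<Rightarrow> real"
  assumes "bounded \<Omega>" "open \<Omega>" "first_eigenfunction \<Omega> \<phi>" "u \<in> H_space \<Omega>"
  shows "first_eigenvalue \<Omega> * L2_form u u \<le> EL_form u u"
proof (cases "L2_form u u = 0")
  case True
  then show ?thesis
    using abs_EL_form_minus_E_form_le[OF assms(1,2,4)] E_form_self_nonneg[of u] by simp
next
  case False
  then have pos: "L2_form u u > 0" using L2_form_self_nonneg[of u] by simp
  define a where "a = 1 / sqrt (L2_form u u)"
  have a2: "a\<^sup>2 = 1 / L2_form u u" using pos by (simp add: a_def power_divide)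
  have "(\<lambda>x. a * u x) \<in> L2_sphere \<Omega>"
    using pos assms(4) by (simp add: L2_sphere_iff H_space_scale L2_form_scale a2)
  then have "first_eigenvalue \<Omega> \<le> a\<^sup>2 * EL_form u u"
    using first_eigenfunctionD(4,5)[OF assms(3)] EL_form_scale[OF assms(1,2,4), of a] by metis
  then show ?thesis using pos by (simp add: a2 field_simps)
qed

text \<open>
  Otherwise a small step against the sign of the linear coefficient makes the expression negative.
\<close>
lemma linear_term_vanishes:
  fixes B q :: real
  assumes "\<And>h. 0 \<le> h * B + h\<^sup>2 * q"
  shows "B = 0"
proof (rule ccontr)
  assume "B \<noteq> 0"
  define t where "t = 1 / (\<bar>q\<bar> + 1)"
  have t: "t > 0" "t * (\<bar>q\<bar> + 1) = 1" by (auto simp: t_def add_pos_nonneg)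
  have "t * \<bar>q\<bar> < 1" using t by (simp add: algebra_simps)
  moreover have "t * q \<le> t * \<bar>q\<bar>" using t by (intro mult_left_mono) auto
  ultimately have "t * q < 1" by linarith
  then have "t * B\<^sup>2 * (t * q - 1) < 0"
    using t \<open>B \<noteq> 0\<close> by (intro mult_pos_neg) auto
  moreover have "0 \<le> (- t * B) * B + (- t * B)\<^sup>2 * q" by (rule assms)
  ultimately show False by (simp add: power2_eq_square algebra_simps)
qed

text \<open>
  The eigenfunction minimises the nonnegative quadratic form Q and gives it the value 0, so it lies
  in the radical of Q: the mixed term vanishes. Adding any multiple of the eigenfunction therefore
  leaves Q unchanged, which turns the energy along a segment through the eigenfunction into an
  exact formula.
\<close>
lemma spectral_gap_lincomb:
  fixes v :: "'a::euclidean_space \<Rightarrow> real"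
  assumes "bounded \<Omega>" "open \<Omega>" "first_eigenfunction \<Omega> \<phi>" "v \<in> H_space \<Omega>"
  defines "Q \<equiv> \<lambda>u. EL_form u u - first_eigenvalue \<Omega> * L2_form u u"
  shows "Q (\<lambda>x. a * \<phi> x + b * v x) = b\<^sup>2 * Q v"
proof -
  note \<phi> = first_eigenfunctionD[OF assms(3)]
  define B where "B = EL_form \<phi> v + EL_form v \<phi> - 2 * first_eigenvalue \<Omega> * L2_form \<phi> v"
  have exp: "Q (\<lambda>x. a * \<phi> x + b * v x) = a * b * B + b\<^sup>2 * Q v" for a b
    unfolding Q_def EL_form_lincomb[OF assms(1,2) \<phi>(1) assms(4)] L2_form_lincomb[OF \<phi>(1) assms(4)] B_def
    using \<phi>(2,4) by (simp add: algebra_simps)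
  have "0 \<le> h * B + h\<^sup>2 * Q v" for h
    using first_eigenvalue_le_Rayleigh[OF assms(1-3) H_space_lincomb[OF \<phi>(1) assms(4), of 1 h]] exp[of 1 h]
    by (simp add: Q_def)
  then have "B = 0" by (rule linear_term_vanishes)
  then show ?thesis using exp[of a b] by simp
qed

section \<open>Bumps of small energy\<close>

text \<open>
  The kernel is just not integrable at the origin; the additional square root of the norm makes it
  integrable. On the ball of radius (1/2)^n minus the next smaller one, the function is at most
  a constant times q^n 2^(nN) with q = sqrt (1/2), and the measure of the ball compensates the
  second factor, so a geometric series dominates the integral.
\<close>
lemma integrable_sqrt_norm_k_kernel:
  "integrable lborel (\<lambda>z :: 'a::euclidean_space. sqrt (norm z) * k_kernel z)"
proof (rule integrableI_nonneg)
  let ?N = "DIM('a)"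
  let ?V = "unit_ball_vol (real ?N)"
  define q :: real where "q = sqrt (1 / 2)"
  have q: "0 < q" "q < 1" unfolding q_def by (auto simp: real_sqrt_lt_1_iff)
  define a :: "nat \<Rightarrow> real" where "a n = q ^ n * 2 ^ ((n + 1) * ?N)" for n
  have a0: "a n \<ge> 0" for n using q by (simp add: a_def)
  have "ennreal (sqrt (norm z) * k_kernel z) \<le> (\<Sum>n. ennreal (a n) * indicator (cball 0 ((1/2)^n)) z)" for z :: 'a
  proof (cases "z = 0 \<or> norm z \<ge> 1")
    case True
    then show ?thesis by (auto simp: k_kernel_def)
  next
    case False
    \<comment> \<open>The shell that contains z: the norm lies between (1/2)^(m+1) and (1/2)^m.\<close>
    define n where "n = (LEAST n. (1/2::real) ^ n < norm z)"
    have "\<exists>n. (1/2::real) ^ n < norm z" using False by (intro real_arch_pow_inv) auto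
    then have n: "(1/2) ^ n < norm z" unfolding n_def by (rule LeastI_ex)
    then have "n \<noteq> 0" using False by (intro notI) simp
    then obtain m where m: "n = Suc m" by (cases n) auto
    have "\<not> (1/2) ^ m < norm z" unfolding m
      using m not_less_Least[of m "\<lambda>n. (1/2::real) ^ n < norm z"] n_def by auto
    then have zm: "norm z \<le> (1/2) ^ m" by simp
    have "sqrt (norm z) \<le> sqrt ((1/2) ^ m)" using zm by simp
    also have "\<dots> = q ^ m" by (simp add: q_def real_sqrt_power)
    finally have 1: "sqrt (norm z) \<le> q ^ m" .
    have "1 / norm z \<le> 2 ^ (m + 1)"
      using n m False by (simp add: field_simps power_one_over)
    then have "(1 / norm z) ^ ?N \<le> (2 ^ (m + 1)) ^ ?N" by (intro power_mono) auto
    then have 2: "k_kernel z \<le> 2 ^ ((m + 1) * ?N)"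
      using False by (simp add: k_kernel_def power_one_over power_add power_mult indicator_def)
    have "sqrt (norm z) * k_kernel z \<le> a m"
      unfolding a_def using 1 2 q by (intro mult_mono) (auto simp: k_kernel_nonneg)
    then have "ennreal (sqrt (norm z) * k_kernel z) \<le> ennreal (a m) * indicator (cball 0 ((1/2)^m)) z"
      using zm by (simp add: ennreal_leI)
    also have "\<dots> \<le> (\<Sum>n. ennreal (a n) * indicator (cball 0 ((1/2)^n)) z)"
    proof -
      have "f m \<le> suminf f" for f :: "nat \<Rightarrow> ennreal" using sum_le_suminf[of f "{m}"] by simp
      then show ?thesis .
    qed
    finally show ?thesis .
  qed
  then have "(\<integral>\<^sup>+ z. ennreal (sqrt (norm z) * k_kernel z) \<partial>(lborel :: 'a measure))
      \<le> (\<integral>\<^sup>+ z. (\<Sum>n. ennreal (a n) * indicator (cball 0 ((1/2)^n)) z) \<partial>(lborel :: 'a measure))"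
    by (intro nn_integral_mono) auto
  also have "\<dots> = (\<Sum>n. \<integral>\<^sup>+ z. ennreal (a n) * indicator (cball 0 ((1/2)^n)) z \<partial>(lborel :: 'a measure))"
    by (intro nn_integral_suminf borel_measurable_times_ennreal borel_measurable_indicator) auto
  also have "\<dots> = (\<Sum>n. ennreal (2 ^ ?N * ?V * q ^ n))"
  proof (intro suminf_cong)
    fix n
    have "(\<integral>\<^sup>+ z. ennreal (a n) * indicator (cball 0 ((1/2)^n)) z \<partial>(lborel :: 'a measure))
        = ennreal (a n) * ennreal (?V * ((1/2)^n) ^ ?N)"
      by (simp add: nn_integral_cmult_indicator emeasure_cball)
    also have "\<dots> = ennreal (a n * (?V * ((1/2)^n) ^ ?N))"
      using a0 by (intro ennreal_mult'[symmetric]) auto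
    also have "a n * (?V * ((1/2)^n) ^ ?N) = 2 ^ ?N * ?V * q ^ n"
    proof -
      have "((1/2)^n) ^ ?N = 1 / (2::real) ^ (n * ?N)" by (simp add: power_one_over power_mult)
      moreover have "(2::real) ^ ((n + 1) * ?N) = 2 ^ (n * ?N) * 2 ^ ?N" by (simp add: algebra_simps power_add)
      ultimately show ?thesis by (simp add: a_def)
    qed
    finally show "(\<integral>\<^sup>+ z. ennreal (a n) * indicator (cball 0 ((1/2)^n)) z \<partial>(lborel :: 'a measure))
      = ennreal (2 ^ ?N * ?V * q ^ n)" .
  qed
  also have "\<dots> < \<infinity>"
  proof -
    have "summable (\<lambda>n. 2 ^ ?N * ?V * q ^ n)" using q by (intro summable_mult summable_geometric) auto
    then show ?thesis using q by (subst suminf_ennreal2) auto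
  qed
  finally show "(\<integral>\<^sup>+ z. ennreal (sqrt (norm z) * k_kernel z) \<partial>(lborel :: 'a measure)) < \<infinity>" .
qed (auto simp: k_kernel_nonneg)

text \<open>
  Fubini and translation invariance. Evenness avoids a reflection in the inner integral.
\<close>
lemma integral_times_translated_even:
  fixes f h :: "'a::euclidean_space \<Rightarrow> real"
  assumes f: "integrable lborel f" and h: "integrable lborel h" and even: "\<And>z. h (- z) = h z"
  shows "integrable (lborel \<Otimes>\<^sub>M lborel) (\<lambda>(x, y). f x * h (x - y))"
    and "(LINT (x, y)|(lborel \<Otimes>\<^sub>M lborel). f x * h (x - y)) = (LINT x|lborel. f x) * (LINT z|lborel. h z)"
proof -
  have [measurable]: "f \<in> borel_measurable borel" "h \<in> borel_measurable borel"
    using f h by (auto dest: borel_measurable_integrable)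
  have tr: "integrable lborel (\<lambda>y. h (x - y))" "(LINT y|lborel. h (x - y)) = (LINT z|lborel. h z)"
    if h: "integrable lborel h" and even: "\<And>z. h (- z) = h z" for h :: "'a \<Rightarrow> real" and x
  proof -
    have [measurable]: "h \<in> borel_measurable borel" using h by (auto dest: borel_measurable_integrable)
    have eq: "h (x - y) = h (- x + y)" for y using even[of "x - y"] by simp
    have "integrable (distr lborel borel ((+) (- x))) h" using h by (simp add: lborel_distr_plus)
    then show "integrable lborel (\<lambda>y. h (x - y))" unfolding eq
      by (subst (asm) integrable_distr_eq) auto
    have "(LINT z|lborel. h z) = (LINT z|distr lborel borel ((+) (- x)). h z)" by (simp add: lborel_distr_plus)
    also have "\<dots> = (LINT y|lborel. h (x - y))" unfolding eq
      by (subst integral_distr) auto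
    finally show "(LINT y|lborel. h (x - y)) = (LINT z|lborel. h z)" ..
  qed
  have n: "(LINT y|lborel. \<bar>h (x - y)\<bar>) = (LINT z|lborel. \<bar>h z\<bar>)" for x
    using tr(2)[of "\<lambda>z. \<bar>h z\<bar>"] h even by simp
  have "integrable (lborel \<Otimes>\<^sub>M lborel) (\<lambda>z. f (fst z) * h (fst z - snd z))"
    using f tr(1)[OF h even] by (intro lborel_pair.Fubini_integrable) (auto simp: abs_mult n)
  then show i: "integrable (lborel \<Otimes>\<^sub>M lborel) (\<lambda>(x, y). f x * h (x - y))"
    by (simp add: split_beta')
  from lborel_pair.integral_fst'[OF i]
  show "(LINT (x, y)|(lborel \<Otimes>\<^sub>M lborel). f x * h (x - y)) = (LINT x|lborel. f x) * (LINT z|lborel. h z)"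
    by (simp add: tr(2)[OF h even])
qed

text \<open>
  The test function: a Lipschitz cone of height 1 over the ball of radius \<open>\<rho>\<close> around \<open>p\<close>.
\<close>
definition tent :: "'a::euclidean_space \<Rightarrow> real \<Rightarrow> 'a \<Rightarrow> real" where
  "tent p \<rho> x = max 0 (1 - norm (x - p) / \<rho>)"

lemma tent_measurable [measurable]: "tent p \<rho> \<in> borel_measurable borel"
  unfolding tent_def by measurable

lemma tent_bounds: "\<rho> > 0 \<Longrightarrow> 0 \<le> tent p \<rho> x" "\<rho> > 0 \<Longrightarrow> tent p \<rho> x \<le> 1"
  unfolding tent_def by auto

lemma tent_outside: "\<rho> > 0 \<Longrightarrow> x \<notin> ball p \<rho> \<Longrightarrow> tent p \<rho> x = 0"
  unfolding tent_def by (auto simp: dist_norm norm_minus_commute max_def divide_simps)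

lemma tent_ge_half: "\<rho> > 0 \<Longrightarrow> x \<in> ball p (\<rho> / 2) \<Longrightarrow> tent p \<rho> x \<ge> 1 / 2"
  unfolding tent_def by (auto simp: dist_norm norm_minus_commute max_def divide_simps)

text \<open>
  The increment is at most 1 and at most w = |x - y| / \<open>\<rho>\<close>, so its square is at most the square root
  of w. This gives away most of the decay at the diagonal, but keeps just enough of it to beat the
  singularity of the kernel, and it costs only a factor of order \<open>\<rho>\<close> to the power -1/2.
\<close>
lemma tent_increment:
  assumes "\<rho> > 0"
  shows "\<bar>tent p \<rho> x - tent p \<rho> y\<bar>\<^sup>2 \<le>
    (indicator (ball p \<rho>) x + indicator (ball p \<rho>) y) * (sqrt (norm (x - y)) / sqrt \<rho>)"
proof (cases "x \<in> ball p \<rho> \<or> y \<in> ball p \<rho>")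
  case True
  define d where "d = \<bar>tent p \<rho> x - tent p \<rho> y\<bar>"
  define w where "w = norm (x - y) / \<rho>"
  have w0: "w \<ge> 0" using assms by (simp add: w_def)
  have d01: "0 \<le> d" "d \<le> 1"
    using tent_bounds[OF assms, of p x] tent_bounds[OF assms, of p y] by (auto simp: d_def)
  have "d \<le> \<bar>norm (x - p) / \<rho> - norm (y - p) / \<rho>\<bar>"
    unfolding d_def tent_def by (auto simp: max_def)
  also have "\<dots> = \<bar>norm (x - p) - norm (y - p)\<bar> / \<rho>"
    using assms by (simp add: diff_divide_distrib[symmetric])
  also have "\<dots> \<le> w"
    unfolding w_def using assms norm_triangle_ineq3[of "x - p" "y - p"] by (intro divide_right_mono) auto
  finally have dw: "d \<le> w" .
  have "d\<^sup>2 \<le> d" using d01 by (simp add: power2_eq_square mult_left_le)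
  also have "d \<le> sqrt w"
  proof -
    have "d\<^sup>2 \<le> w" using \<open>d\<^sup>2 \<le> d\<close> dw by simp
    then show ?thesis using d01 by (simp add: real_le_rsqrt)
  qed
  also have "sqrt w = sqrt (norm (x - y)) / sqrt \<rho>" by (simp add: w_def real_sqrt_divide)
  also have "\<dots> \<le> (indicator (ball p \<rho>) x + indicator (ball p \<rho>) y) * (sqrt (norm (x - y)) / sqrt \<rho>)"
  proof -
    have "(1::real) \<le> indicator (ball p \<rho>) x + indicator (ball p \<rho>) y"
      using True by (auto simp: indicator_def)
    moreover have "0 \<le> sqrt (norm (x - y)) / sqrt \<rho>" using assms by simp
    ultimately show ?thesis using mult_right_mono by fastforce
  qed
  finally show ?thesis by (simp add: d_def)
next
  case False
  then show ?thesis using tent_outside[OF assms, of x p] tent_outside[OF assms, of y p] by auto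
qed

lemma tent_energy:
  fixes p :: "'a::euclidean_space"
  assumes "\<rho> > 0"
  defines "h \<equiv> \<lambda>z :: 'a. sqrt (norm z) * k_kernel z"
  shows "integrable (lborel \<Otimes>\<^sub>M lborel) (\<lambda>(x, y). \<bar>tent p \<rho> x - tent p \<rho> y\<bar>\<^sup>2 * k_kernel (x - y))" (is ?A)
    and "E_form (tent p \<rho>) (tent p \<rho>) \<le> c_const TYPE('a) * measure lborel (ball p \<rho>) * (LINT z|lborel. h z) / sqrt \<rho>" (is ?B)
proof -
  let ?b = "indicator (ball p \<rho>) :: 'a \<Rightarrow> real"
  define F where "F = (\<lambda>(x, y). ?b x * h (x - y))"
  define G where "G = (\<lambda>(x, y). ?b y * h (x - y))"
  have b: "integrable lborel ?b" using emeasure_lborel_ball_finite[of p \<rho>] by simp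
  have h: "integrable lborel h" unfolding h_def by (rule integrable_sqrt_norm_k_kernel)
  have even: "h (- z) = h z" for z
    unfolding h_def using k_kernel_commute[of z 0] by simp
  have F: "integrable (lborel \<Otimes>\<^sub>M lborel) F"
    "(LINT z|(lborel \<Otimes>\<^sub>M lborel). F z) = measure lborel (ball p \<rho>) * (LINT z|lborel. h z)"
    unfolding F_def using integral_times_translated_even[OF b h even] by simp_all
  have GF: "G = (\<lambda>(x, y). F (y, x))"
    unfolding F_def G_def using even by (auto simp: fun_eq_iff) (metis minus_diff_eq)
  have G: "integrable (lborel \<Otimes>\<^sub>M lborel) G"
    "(LINT z|(lborel \<Otimes>\<^sub>M lborel). G z) = measure lborel (ball p \<rho>) * (LINT z|lborel. h z)"
    unfolding GF using lborel_pair.integrable_product_swap[OF F(1)]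
      lborel_pair.integral_product_swap[of F] F by auto
  let ?T = "\<lambda>(x, y). \<bar>tent p \<rho> x - tent p \<rho> y\<bar>\<^sup>2 * k_kernel (x - y)"
  have le: "?T z \<le> (F z + G z) / sqrt \<rho>" for z
  proof (cases z)
    case (Pair x y)
    have "?T z \<le> (?b x + ?b y) * (sqrt (norm (x - y)) / sqrt \<rho>) * k_kernel (x - y)"
      using mult_right_mono[OF tent_increment[OF assms(1), of p x y] k_kernel_nonneg[of "x - y"]] Pair by simp
    then show ?thesis unfolding Pair F_def G_def h_def by (simp add: algebra_simps add_divide_distrib)
  qed
  have dom: "integrable (lborel \<Otimes>\<^sub>M lborel) (\<lambda>z. (F z + G z) / sqrt \<rho>)" using F G by simp
  have T0: "?T z \<ge> 0" for z by (auto simp: k_kernel_nonneg split: prod.splits)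
  show A: ?A
  proof (rule Bochner_Integration.integrable_bound[OF dom])
    show "?T \<in> borel_measurable (lborel \<Otimes>\<^sub>M lborel)" by measurable
    show "AE z in lborel \<Otimes>\<^sub>M lborel. norm (?T z) \<le> norm ((F z + G z) / sqrt \<rho>)"
    proof (rule AE_I2)
      fix z show "norm (?T z) \<le> norm ((F z + G z) / sqrt \<rho>)" using le[of z] T0[of z] unfolding real_norm_def by linarith
    qed
  qed
  have "(LINT z|(lborel \<Otimes>\<^sub>M lborel). ?T z) \<le> (LINT z|(lborel \<Otimes>\<^sub>M lborel). (F z + G z) / sqrt \<rho>)"
    using A dom le by (intro integral_mono) auto
  also have "\<dots> = 2 * (measure lborel (ball p \<rho>) * (LINT z|lborel. h z)) / sqrt \<rho>"
    using F G by simp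
  finally have "c_const TYPE('a) / 2 * (LINT z|(lborel \<Otimes>\<^sub>M lborel). ?T z)
      \<le> c_const TYPE('a) / 2 * (2 * (measure lborel (ball p \<rho>) * (LINT z|lborel. h z)) / sqrt \<rho>)"
    using c_const_nonneg[where 'a = 'a] by (intro mult_left_mono) auto
  then show ?B unfolding E_form_def by (simp add: power2_eq_square algebra_simps split_beta')
qed

lemma tent_in_H_space:
  assumes "\<rho> > 0" "ball p \<rho> \<subseteq> \<Omega>"
  shows "tent p \<rho> \<in> H_space \<Omega>" and "L2_form (tent p \<rho>) (tent p \<rho>) \<le> measure lborel (ball p \<rho>)"
proof -
  have b: "integrable lborel (indicator (ball p \<rho>) :: 'a \<Rightarrow> real)"
    using emeasure_lborel_ball_finite[of p \<rho>] by simp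
  have le: "(tent p \<rho> x)\<^sup>2 \<le> indicator (ball p \<rho>) x" for x
    using tent_bounds[OF assms(1), of p x] tent_outside[OF assms(1), of x p]
    by (cases "x \<in> ball p \<rho>") (auto simp: power_le_one)
  have i: "integrable lborel (\<lambda>x. (tent p \<rho> x)\<^sup>2)"
    by (rule Bochner_Integration.integrable_bound[OF b]) (use le in \<open>auto intro!: AE_I2\<close>)
  have "tent p \<rho> x = 0" if "x \<notin> \<Omega>" for x
    using that assms tent_outside[OF assms(1), of x p] by blast
  then show "tent p \<rho> \<in> H_space \<Omega>"
    unfolding H_space_def using i tent_energy(1)[OF assms(1), of p] by auto
  have "L2_form (tent p \<rho>) (tent p \<rho>) = (LINT x|lborel. (tent p \<rho> x)\<^sup>2)"
    by (simp add: L2_form_def power2_eq_square)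
  also have "\<dots> \<le> (LINT x|lborel. indicator (ball p \<rho>) x)"
    using i b le by (intro integral_mono) auto
  finally show "L2_form (tent p \<rho>) (tent p \<rho>) \<le> measure lborel (ball p \<rho>)" by simp
qed

text \<open>
  Points have zero capacity for this energy, in every dimension including 1: the bound in
  \<open>tent_energy\<close> is of order \<open>\<rho>\<close> to the power N - 1/2. Hence a function of height 1 near a given
  point can be as small as desired in the energy and in the square norm.
\<close>
lemma tent_forms_small:
  fixes p :: "'a::euclidean_space"
  assumes "\<rho>\<^sub>0 > 0" "\<eta> > 0"
  obtains \<rho> where "0 < \<rho>" "\<rho> \<le> \<rho>\<^sub>0" "E_form (tent p \<rho>) (tent p \<rho>) < \<eta>" "measure lborel (ball p \<rho>) < \<eta>"
proof -
  define V where "V = unit_ball_vol (real DIM('a))"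
  define H where "H = c_const TYPE('a) * V * (LINT z|(lborel :: 'a measure). sqrt (norm z) * k_kernel z)"
  have "((\<lambda>\<rho>. H * sqrt \<rho>) \<longlongrightarrow> H * sqrt 0) (at_right 0)" "((\<lambda>\<rho>. V * \<rho>) \<longlongrightarrow> V * 0) (at_right 0)"
    by (intro tendsto_intros)+
  then have "\<forall>\<^sub>F \<rho> in at_right 0. H * sqrt \<rho> < \<eta>" "\<forall>\<^sub>F \<rho> in at_right 0. V * \<rho> < \<eta>"
    using assms by (auto intro: order_tendstoD)
  moreover have "\<forall>\<^sub>F \<rho> in at_right 0. 0 < \<rho> \<and> \<rho> < min \<rho>\<^sub>0 1"
    using assms eventually_at_right_real[of 0 "min \<rho>\<^sub>0 1"] by (auto elim: eventually_mono)
  ultimately have "\<forall>\<^sub>F \<rho> in at_right 0. H * sqrt \<rho> < \<eta> \<and> V * \<rho> < \<eta> \<and> 0 < \<rho> \<and> \<rho> < min \<rho>\<^sub>0 1"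
    by eventually_elim auto
  then obtain \<rho> where \<rho>: "H * sqrt \<rho> < \<eta>" "V * \<rho> < \<eta>" "0 < \<rho>" "\<rho> < \<rho>\<^sub>0" "\<rho> < 1"
    by (auto dest!: eventually_happens simp: trivial_limit_at_right_real)
  have "\<rho> ^ DIM('a) \<le> \<rho> ^ 1" using \<rho> by (intro power_decreasing) auto
  then have m: "measure lborel (ball p \<rho>) \<le> V * \<rho>"
    using \<rho> by (simp add: V_def content_ball mult_left_mono)
  have "E_form (tent p \<rho>) (tent p \<rho>)
      \<le> c_const TYPE('a) * measure lborel (ball p \<rho>) * (LINT z|(lborel :: 'a measure). sqrt (norm z) * k_kernel z) / sqrt \<rho>"
    by (rule tent_energy(2)[OF \<rho>(3)])
  also have "\<dots> \<le> c_const TYPE('a) * (V * \<rho>) * (LINT z|(lborel :: 'a measure). sqrt (norm z) * k_kernel z) / sqrt \<rho>"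
    using m \<rho> c_const_nonneg[where 'a = 'a]
    by (intro divide_right_mono mult_right_mono mult_left_mono Bochner_Integration.integral_nonneg)
       (auto simp: k_kernel_nonneg)
  also have "\<dots> = H * (\<rho> / sqrt \<rho>)" by (simp add: H_def)
  also have "\<dots> = H * sqrt \<rho>" using \<rho> by (simp add: real_div_sqrt)
  finally show ?thesis using that[of \<rho>] \<rho> m by auto
qed

text \<open>
  Otherwise every point of the set would have a null neighbourhood in it, and by the Lindelof
  property countably many of these would cover the set.
\<close>
lemma exists_support_point:
  fixes S :: "'a::euclidean_space set"
  assumes "S \<in> sets borel" "emeasure lborel S > 0"
  obtains p where "p \<in> S" "\<And>r. r > 0 \<Longrightarrow> emeasure lborel (S \<inter> ball p r) > 0"
proof -
  have neg: "negligible T \<longleftrightarrow> emeasure lborel T = 0" if "T \<in> sets borel" for T :: "'a set"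
    using that by (simp add: negligible_iff_emeasure0)
  have "\<not> negligible S" using neg assms by simp
  then have "\<not> (\<forall>x\<in>S. \<exists>U. openin (top_of_set S) U \<and> x \<in> U \<and> negligible U)"
    using locally_negligible_alt by blast
  then obtain p where p: "p \<in> S" "\<And>U. openin (top_of_set S) U \<Longrightarrow> p \<in> U \<Longrightarrow> \<not> negligible U" by blast
  have "emeasure lborel (S \<inter> ball p r) > 0" if "r > 0" for r
  proof -
    have "openin (top_of_set S) (S \<inter> ball p r)" by (intro openin_open_Int) simp
    then have "\<not> negligible (S \<inter> ball p r)" using p that by auto
    then show ?thesis using neg[of "S \<inter> ball p r"] assms(1) by (auto simp: zero_less_iff_neq_zero)
  qed
  then show ?thesis using that p(1) by blast
qed

section \<open>A path of low energy\<close>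

lemma positive_part_lower_bound:
  assumes "u \<in> H_space \<Omega>" "open \<Omega>" "S \<in> sets lborel" "S \<subseteq> \<Omega>" "emeasure lborel S < \<infinity>"
    and "\<delta> \<ge> 0" "\<And>x. x \<in> S \<Longrightarrow> \<delta> \<le> u x"
  shows "\<delta>\<^sup>2 * measure lborel S \<le> (LINT x:\<Omega>|lborel. (max (u x) 0)\<^sup>2)"
    and "(LINT x:\<Omega>|lborel. (max (u x) 0)\<^sup>2) \<le> L2_form u u"
proof -
  have [measurable]: "u \<in> borel_measurable borel" "\<Omega> \<in> sets borel"
    using H_space_measurable[OF assms(1)] assms(2) by auto
  have u2: "integrable lborel (\<lambda>x. u x * u x)" by (rule H_space_integrable_mult[OF assms(1,1)])
  have le: "indicator \<Omega> x *\<^sub>R (max (u x) 0)\<^sup>2 \<le> u x * u x" for x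
    by (auto simp: indicator_def max_def power2_eq_square)
  have p: "integrable lborel (\<lambda>x. indicator \<Omega> x *\<^sub>R (max (u x) 0)\<^sup>2)"
    by (rule Bochner_Integration.integrable_bound[OF u2]) (use le in \<open>auto intro!: AE_I2\<close>)
  show "(LINT x:\<Omega>|lborel. (max (u x) 0)\<^sup>2) \<le> L2_form u u"
    unfolding L2_form_def set_lebesgue_integral_def using p u2 le by (intro integral_mono) auto
  have S: "integrable lborel (\<lambda>x. \<delta>\<^sup>2 * indicator S x)" using assms(3,5) by simp
  have "\<delta>\<^sup>2 * indicator S x \<le> indicator \<Omega> x *\<^sub>R (max (u x) 0)\<^sup>2" for x
    using assms(4,6) assms(7)[of x] by (auto simp: indicator_def intro!: power_mono)
  then have "(LINT x|lborel. \<delta>\<^sup>2 * indicator S x) \<le> (LINT x:\<Omega>|lborel. (max (u x) 0)\<^sup>2)"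
    unfolding set_lebesgue_integral_def using p S by (intro integral_mono) auto
  then show "\<delta>\<^sup>2 * measure lborel S \<le> (LINT x:\<Omega>|lborel. (max (u x) 0)\<^sup>2)"
    using assms(3) by simp
qed

lemma L2_form_eq_0_AE:
  assumes "u \<in> H_space \<Omega>" "L2_form u u = 0"
  shows "AE x in lborel. u x = 0"
proof -
  have "AE x in lborel. u x * u x = 0"
    using assms(2) H_space_integrable_mult[OF assms(1,1)] unfolding L2_form_def
    by (subst (asm) integral_nonneg_eq_0_iff_AE) auto
  then show ?thesis by simp
qed

text \<open>
  The segment from minus the eigenfunction to the bump, followed by the one from the bump to the
  eigenfunction, projected to the sphere. All its points lie in the plane spanned by the two
  functions, so continuity in the energy norm is continuity of the two coefficients.
\<close>
lemma normalised_path_admissible: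
  fixes \<phi> b :: "'a::euclidean_space \<Rightarrow> real"
  assumes \<phi>: "\<phi> \<in> H_space \<Omega>" "L2_form \<phi> \<phi> = 1" and b: "b \<in> H_space \<Omega>"
  defines "u \<equiv> \<lambda>t x. t * \<phi> x + (1 - \<bar>t\<bar>) * b x"
  assumes pos: "\<And>t. t \<in> {-1..1} \<Longrightarrow> L2_form (u t) (u t) > 0"
  shows "(\<lambda>t x. 1 / sqrt (L2_form (u t) (u t)) * u t x) \<in> admissible_paths \<Omega> \<phi>" (is "?\<gamma> \<in> _")
proof -
  define n where "n t = sqrt (L2_form (u t) (u t))" for t
  have uH: "u t \<in> H_space \<Omega>" for t unfolding u_def by (rule H_space_lincomb[OF \<phi>(1) b])
  have L2: "L2_form (u t) (u t) = t\<^sup>2 + 2 * t * (1 - \<bar>t\<bar>) * L2_form \<phi> b + (1 - \<bar>t\<bar>)\<^sup>2 * L2_form b b" for t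
    unfolding u_def L2_form_lincomb[OF \<phi>(1) b] using \<phi>(2) by simp
  have n_cont: "(n \<longlongrightarrow> n t) (at t within {-1..1})" for t
    unfolding n_def L2 by (intro tendsto_intros)
  have n_pos: "n t > 0" if "t \<in> {-1..1}" for t using pos[OF that] by (simp add: n_def)
  have sphere: "?\<gamma> t \<in> L2_sphere \<Omega>" if "t \<in> {-1..1}" for t
  proof -
    have "(1 / sqrt (L2_form (u t) (u t)))\<^sup>2 * L2_form (u t) (u t) = 1"
      using pos[OF that] by (simp add: power_divide)
    then show ?thesis
      using H_space_scale[OF uH] by (simp only: L2_sphere_iff L2_form_scale[OF uH] simp_thms)
  qed
  have cont: "((\<lambda>s. H_norm (\<lambda>x. ?\<gamma> s x - ?\<gamma> t x)) \<longlongrightarrow> 0) (at t within {-1..1})" if t: "t \<in> {-1..1}" for t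
  proof -
    define \<alpha> where "\<alpha> s = s / n s - t / n t" for s
    define \<beta> where "\<beta> s = (1 - \<bar>s\<bar>) / n s - (1 - \<bar>t\<bar>) / n t" for s
    have "(\<lambda>x. ?\<gamma> s x - ?\<gamma> t x) = (\<lambda>x. \<alpha> s * \<phi> x + \<beta> s * b x)" for s
      unfolding \<alpha>_def \<beta>_def n_def u_def by (simp add: fun_eq_iff algebra_simps add_divide_distrib diff_divide_distrib)
    then have eq: "H_norm (\<lambda>x. ?\<gamma> s x - ?\<gamma> t x) =
        sqrt ((\<alpha> s)\<^sup>2 * E_form \<phi> \<phi> + 2 * \<alpha> s * \<beta> s * E_form \<phi> b + (\<beta> s)\<^sup>2 * E_form b b)" for s
      unfolding H_norm_def by (simp add: E_form_lincomb[OF \<phi>(1) b])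
    have "(\<alpha> \<longlongrightarrow> t / n t - t / n t) (at t within {-1..1})"
      unfolding \<alpha>_def using n_pos[OF t] by (intro tendsto_intros n_cont) auto
    moreover have "(\<beta> \<longlongrightarrow> (1 - \<bar>t\<bar>) / n t - (1 - \<bar>t\<bar>) / n t) (at t within {-1..1})"
      unfolding \<beta>_def using n_pos[OF t] by (intro tendsto_intros n_cont) auto
    ultimately have "((\<lambda>s. sqrt ((\<alpha> s)\<^sup>2 * E_form \<phi> \<phi> + 2 * \<alpha> s * \<beta> s * E_form \<phi> b + (\<beta> s)\<^sup>2 * E_form b b))
        \<longlongrightarrow> sqrt (0\<^sup>2 * E_form \<phi> \<phi> + 2 * 0 * 0 * E_form \<phi> b + 0\<^sup>2 * E_form b b)) (at t within {-1..1})"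
      by (intro tendsto_intros) auto
    then show ?thesis unfolding eq by simp
  qed
  have "?\<gamma> (-1) x = - \<phi> x" "?\<gamma> 1 x = \<phi> x" for x
    using L2[of 1] L2[of "-1"] by (simp_all add: u_def)
  then show ?thesis
    unfolding admissible_paths_def using sphere cont by auto
qed

text \<open>
  Let d be the coefficient of the bump b. By \<open>spectral_gap_lincomb\<close> the excess of the logarithmic
  form over the eigenvalue is exactly d^2 Q(b). Two regimes are compared.

  If d \<open>\<ge>\<close> -4At, the bump wins on S, where the eigenfunction is below A: there the function is at least
  d/4, so the positive part has square norm of order d^2 and a large r absorbs the excess.

  If d < -4At, then t < 0 and the function is close to a multiple of minus the eigenfunction: its
  square norm is at least t^2/4, while the excess is at most 16 A^2 t^2 Q(b), a small fraction of it.
\<close>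
lemma low_level_estimate:
  fixes b :: "'a::euclidean_space \<Rightarrow> real"
  assumes \<Omega>: "bounded \<Omega>" "open \<Omega>" and \<phi>: "first_eigenfunction \<Omega> \<phi>" and b: "b \<in> H_space \<Omega>"
    and t: "t \<in> {-1..1}"
    and S: "S \<in> sets lborel" "S \<subseteq> \<Omega>" "\<And>x. x \<in> S \<Longrightarrow> 0 < \<phi> x \<and> \<phi> x < A \<and> 1 / 2 \<le> b x"
    and A: "A > 0" and small: "64 * A\<^sup>2 * L2_form b b \<le> 1"
      "64 * A\<^sup>2 * (EL_form b b - first_eigenvalue \<Omega> * L2_form b b) \<le> \<epsilon>"
    and r: "r \<ge> 0" "16 * (EL_form b b - first_eigenvalue \<Omega> * L2_form b b) \<le> r * measure lborel S"
  defines "u \<equiv> \<lambda>x. t * \<phi> x + (1 - \<bar>t\<bar>) * b x"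
  shows "E_functional \<Omega> r u \<le> (first_eigenvalue \<Omega> + \<epsilon>) * L2_form u u"
proof -
  note \<phi>' = first_eigenfunctionD[OF \<phi>]
  define q where "q = EL_form b b - first_eigenvalue \<Omega> * L2_form b b"
  define d where "d = 1 - \<bar>t\<bar>"
  define P where "P = (LINT x:\<Omega>|lborel. (max (u x) 0)\<^sup>2)"
  have q0: "q \<ge> 0" unfolding q_def using first_eigenvalue_le_Rayleigh[OF \<Omega> \<phi> b] by simp
  have d0: "d \<ge> 0" using t by (auto simp: d_def)
  have uH: "u \<in> H_space \<Omega>" unfolding u_def by (rule H_space_lincomb[OF \<phi>'(1) b])
  have Q: "EL_form u u - first_eigenvalue \<Omega> * L2_form u u = d\<^sup>2 * q"
    using spectral_gap_lincomb[OF \<Omega> \<phi> b, of t "1 - \<bar>t\<bar>"] unfolding u_def d_def q_def .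
  have P0: "P \<ge> 0"
    unfolding P_def set_lebesgue_integral_def by (intro Bochner_Integration.integral_nonneg) auto
  have \<epsilon>0: "\<epsilon> \<ge> 0"
  proof -
    have "0 \<le> 64 * A\<^sup>2 * q" using q0 by simp
    then show ?thesis using small(2) by (simp add: q_def)
  qed
  have "d\<^sup>2 * q - r * P \<le> \<epsilon> * L2_form u u"
  proof (cases "d \<ge> - 4 * A * t")
    case True
    have finS: "emeasure lborel S < \<infinity>"
      using S(2) emeasure_bounded_finite[OF bounded_subset[OF \<Omega>(1)]] by blast
    have "d / 4 \<le> u x" if "x \<in> S" for x
    proof -
      have "t * \<phi> x \<ge> - d / 4"
      proof (cases "t \<ge> 0")
        case True
        then have "0 \<le> t * \<phi> x" using S(3)[OF that] by simp
        then show ?thesis using d0 by linarith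
      next
        case False
        then have "t * \<phi> x \<ge> t * A" using S(3)[OF that] by (intro mult_left_mono_neg) auto
        then show ?thesis using True by (simp add: algebra_simps)
      qed
      moreover have "d * b x \<ge> d * (1 / 2)" using S(3)[OF that] d0 by (intro mult_left_mono) auto
      ultimately show ?thesis unfolding u_def d_def[symmetric] by simp
    qed
    then have "(d / 4)\<^sup>2 * measure lborel S \<le> P"
      unfolding P_def using d0 by (intro positive_part_lower_bound(1)[OF uH \<Omega>(2) S(1,2) finS]) auto
    then have "r * ((d / 4)\<^sup>2 * measure lborel S) \<le> r * P" using r by (intro mult_left_mono) auto
    moreover have "d\<^sup>2 / 16 * (16 * q) \<le> d\<^sup>2 / 16 * (r * measure lborel S)"
      using r(2) by (intro mult_left_mono) (auto simp: q_def)
    ultimately have "d\<^sup>2 * q \<le> r * P" by (simp add: power_divide algebra_simps)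
    moreover have "0 \<le> \<epsilon> * L2_form u u" using \<epsilon>0 L2_form_self_nonneg[of u] by simp
    ultimately show ?thesis by linarith
  next
    case False
    then have lt: "d < 4 * A * (- t)" by simp
    then have "d\<^sup>2 \<le> (4 * A * (- t))\<^sup>2" using d0 by (intro power_mono) auto
    then have d2: "d\<^sup>2 \<le> 16 * A\<^sup>2 * t\<^sup>2" by (simp add: power_mult_distrib)
    \<comment> \<open>Expanding this square bounds the mixed term below by half of the square of t.\<close>
    have "0 \<le> L2_form (\<lambda>x. t * \<phi> x + (2 * d) * b x) (\<lambda>x. t * \<phi> x + (2 * d) * b x)"
      by (rule L2_form_self_nonneg)
    then have "L2_form u u \<ge> t\<^sup>2 / 2 - d\<^sup>2 * L2_form b b"
      unfolding u_def d_def[symmetric] L2_form_lincomb[OF \<phi>'(1) b]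
      using \<phi>'(2) by (simp add: power_mult_distrib algebra_simps)
    moreover have "d\<^sup>2 * L2_form b b \<le> 16 * A\<^sup>2 * t\<^sup>2 * L2_form b b"
      using d2 L2_form_self_nonneg by (intro mult_right_mono) auto
    moreover have "16 * A\<^sup>2 * t\<^sup>2 * L2_form b b \<le> t\<^sup>2 / 4"
      using mult_left_mono[OF small(1), of "t\<^sup>2 / 4"] by (simp add: algebra_simps)
    ultimately have L: "t\<^sup>2 / 4 \<le> L2_form u u" by linarith
    have "d\<^sup>2 * q \<le> 16 * A\<^sup>2 * t\<^sup>2 * q" using d2 q0 by (intro mult_right_mono) auto
    also have "\<dots> = t\<^sup>2 / 4 * (64 * A\<^sup>2 * q)" by simp
    also have "\<dots> \<le> t\<^sup>2 / 4 * \<epsilon>" using small(2) by (intro mult_left_mono) (auto simp: q_def)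
    also have "\<dots> \<le> \<epsilon> * L2_form u u" using mult_left_mono[OF L \<epsilon>0] by (simp add: mult.commute)
    finally have "d\<^sup>2 * q \<le> \<epsilon> * L2_form u u" .
    moreover have "0 \<le> r * P" using r(1) P0 by simp
    ultimately show ?thesis by linarith
  qed
  then show ?thesis unfolding E_functional_def using Q by (simp add: P_def algebra_simps)
qed

lemma E_functional_scale:
  assumes "bounded \<Omega>" "open \<Omega>" "u \<in> H_space \<Omega>" "a \<ge> 0"
  shows "E_functional \<Omega> r (\<lambda>x. a * u x) = a\<^sup>2 * E_functional \<Omega> r u"
proof -
  have "max (a * u x) 0 = a * max (u x) 0" for x
    using assms(4) by (auto simp: max_def mult_le_0_iff zero_le_mult_iff)
  then show ?thesis
    unfolding E_functional_def EL_form_scale[OF assms(1-3)] by (simp add: power_mult_distrib algebra_simps)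
qed

text \<open>
  The eigenfunction need not be bounded, but it is bounded by some constant on a set of positive
  measure, and that suffices for the comparison with a bump.
\<close>
lemma exists_slab_of_positive_measure:
  fixes \<phi> :: "'a::euclidean_space \<Rightarrow> real"
  assumes "open \<Omega>" "\<Omega> \<noteq> {}" "\<phi> \<in> borel_measurable borel" "AE x in lborel. x \<in> \<Omega> \<longrightarrow> \<phi> x > 0"
  obtains A where "A > 0" "emeasure lborel {x \<in> \<Omega>. 0 < \<phi> x \<and> \<phi> x < A} > 0"
proof -
  have [measurable]: "\<Omega> \<in> sets borel" "\<phi> \<in> borel_measurable borel" using assms by auto
  define T where "T n = {x \<in> \<Omega>. 0 < \<phi> x \<and> \<phi> x < real (Suc n)}" for n
  have [measurable]: "T n \<in> sets borel" for n unfolding T_def by measurable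
  show ?thesis
  proof (cases "\<exists>n. emeasure lborel (T n) > 0")
    case True
    then obtain n where "emeasure lborel (T n) > 0" by blast
    then show ?thesis using that[of "real (Suc n)"] unfolding T_def by simp
  next
    case False
    then have "T n \<in> null_sets lborel" for n by (auto simp: null_sets_def)
    then have "AE x in lborel. \<forall>n. x \<notin> T n"
      by (subst AE_all_countable) (auto intro: AE_not_in)
    with assms(4) have "AE x in lborel. x \<notin> \<Omega>"
    proof eventually_elim
      case (elim x)
      show ?case
      proof
        assume "x \<in> \<Omega>"
        obtain n where "\<phi> x < real n" using reals_Archimedean2 by blast
        then have "x \<in> T n" using elim(1) \<open>x \<in> \<Omega>\<close> by (simp add: T_def)
        then show False using elim by simp
      qed
    qed
    then have "emeasure lborel \<Omega> = 0" by (subst (asm) AE_iff_measurable[of \<Omega>]) auto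
    then have "negligible \<Omega>" by (simp add: negligible_iff_emeasure0)
    then show ?thesis using open_not_negligible assms(1,2) by blast
  qed
qed

text \<open>
  The bound A on the eigenfunction is chosen first, then a support point p of the set where it
  holds, then the radius of the tent at p in terms of A and \<open>\<epsilon>\<close>, and r last, so that one
  path serves all large r.
\<close>
lemma exists_low_path:
  fixes \<phi> :: "'a::euclidean_space \<Rightarrow> real"
  assumes \<Omega>: "bounded \<Omega>" "open \<Omega>" "\<Omega> \<noteq> {}" and \<phi>: "first_eigenfunction \<Omega> \<phi>" and \<epsilon>: "\<epsilon> > 0"
  obtains \<gamma> r\<^sub>0 where "\<gamma> \<in> admissible_paths \<Omega> \<phi>"
    "\<And>r t. r \<ge> r\<^sub>0 \<Longrightarrow> t \<in> {-1..1} \<Longrightarrow> E_functional \<Omega> r (\<gamma> t) \<le> first_eigenvalue \<Omega> + \<epsilon>"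
proof -
  note \<phi>' = first_eigenfunctionD[OF \<phi>]
  have [measurable]: "\<Omega> \<in> sets borel" "\<phi> \<in> borel_measurable borel"
    using \<Omega> H_space_measurable[OF \<phi>'(1)] by auto
  obtain A where A: "A > 0" and posT: "emeasure lborel {x \<in> \<Omega>. 0 < \<phi> x \<and> \<phi> x < A} > 0"
    using exists_slab_of_positive_measure[OF \<Omega>(2,3) _ \<phi>'(3)] by auto
  define T where "T = {x \<in> \<Omega>. 0 < \<phi> x \<and> \<phi> x < A}"
  have [measurable]: "T \<in> sets borel" unfolding T_def by measurable
  obtain p where p: "p \<in> T" "\<And>r. r > 0 \<Longrightarrow> emeasure lborel (T \<inter> ball p r) > 0"
    using exists_support_point[of T] posT by (auto simp: T_def[symmetric])
  obtain \<rho>\<^sub>0 where \<rho>\<^sub>0: "\<rho>\<^sub>0 > 0" "ball p \<rho>\<^sub>0 \<subseteq> \<Omega>"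
    using p(1) \<Omega>(2) unfolding T_def open_contains_ball by blast
  have fin\<Omega>: "emeasure lborel \<Omega> < \<infinity>" by (rule emeasure_bounded_finite[OF \<Omega>(1)])
  have m\<Omega>: "measure lborel \<Omega> > 0"
  proof -
    have "emeasure lborel \<Omega> \<noteq> 0"
      using open_not_negligible[OF \<Omega>(2,3)] negligible_iff_emeasure0[of \<Omega>] by auto
    then show ?thesis using fin\<Omega> by (simp add: measure_def enn2real_positive_iff zero_less_iff_neq_zero)
  qed
  \<comment> \<open>With this constant, Q(b) is at most E(b, b) + K times the square norm of b.\<close>
  define K where "K = 1 + \<bar>rho_const TYPE('a)\<bar> + \<bar>first_eigenvalue \<Omega>\<bar>"
  \<comment> \<open>The last entry keeps the support of the tent from filling the domain.\<close>
  define \<eta> where "\<eta> = Min {\<epsilon> / (64 * A\<^sup>2 * (1 + K)), 1 / (64 * A\<^sup>2), measure lborel \<Omega>}"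
  have K: "K \<ge> 1" by (simp add: K_def)
  have \<eta>: "\<eta> > 0" "\<eta> \<le> \<epsilon> / (64 * A\<^sup>2 * (1 + K))" "\<eta> \<le> 1 / (64 * A\<^sup>2)" "\<eta> \<le> measure lborel \<Omega>"
    unfolding \<eta>_def using A \<epsilon> K m\<Omega> by auto
  obtain \<rho> where \<rho>: "0 < \<rho>" "\<rho> \<le> \<rho>\<^sub>0" "E_form (tent p \<rho>) (tent p \<rho>) < \<eta>" "measure lborel (ball p \<rho>) < \<eta>"
    by (rule tent_forms_small[OF \<rho>\<^sub>0(1) \<eta>(1), of p])
  define b where "b = tent p \<rho>"
  have "ball p \<rho> \<subseteq> \<Omega>" using \<rho>\<^sub>0(2) \<rho>(2) subset_ball by blast
  then have bH: "b \<in> H_space \<Omega>" and b2: "L2_form b b < \<eta>"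
    using tent_in_H_space[OF \<rho>(1), of p \<Omega>] \<rho>(4) by (auto simp: b_def)
  have b0: "b x \<ge> 0" for x unfolding b_def by (rule tent_bounds(1)[OF \<rho>(1)])
  define q where "q = EL_form b b - first_eigenvalue \<Omega> * L2_form b b"
  have "tail_form b b \<ge> 0"
    unfolding tail_form_def using b0 by (intro Bochner_Integration.integral_nonneg) (auto simp: j_kernel_nonneg)
  then have "q \<le> E_form b b + rho_const TYPE('a) * L2_form b b - first_eigenvalue \<Omega> * L2_form b b"
    unfolding q_def EL_form_alt using c_const_nonneg[where 'a = 'a] by simp
  also have "\<dots> \<le> E_form b b + K * L2_form b b"
  proof -
    have "(rho_const TYPE('a) - first_eigenvalue \<Omega>) * L2_form b b \<le> K * L2_form b b"
      unfolding K_def by (intro mult_right_mono L2_form_self_nonneg) auto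
    then show ?thesis by (simp add: algebra_simps)
  qed
  also have "\<dots> \<le> \<eta> + K * \<eta>" using \<rho>(3) b2 K by (intro add_mono mult_left_mono) (auto simp: b_def)
  finally have q: "q \<le> (1 + K) * \<eta>" by (simp add: algebra_simps)
  have "64 * A\<^sup>2 * q \<le> 64 * A\<^sup>2 * ((1 + K) * \<eta>)" using q by (intro mult_left_mono) auto
  also have "\<dots> \<le> \<epsilon>"
  proof -
    have "64 * A\<^sup>2 * (1 + K) > 0" using A K by simp
    then have "\<eta> * (64 * A\<^sup>2 * (1 + K)) \<le> \<epsilon>" using \<eta>(2) by (simp only: pos_le_divide_eq)
    then show ?thesis by (simp add: mult_ac)
  qed
  finally have small2: "64 * A\<^sup>2 * q \<le> \<epsilon>" .
  have "64 * A\<^sup>2 * L2_form b b \<le> 64 * A\<^sup>2 * \<eta>" using b2 by (intro mult_left_mono) auto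
  also have "\<dots> \<le> 1" using \<eta>(3) A by (simp add: field_simps)
  finally have small1: "64 * A\<^sup>2 * L2_form b b \<le> 1" .
  define S where "S = T \<inter> ball p (\<rho> / 2)"
  have S[measurable]: "S \<in> sets lborel" "S \<subseteq> \<Omega>" unfolding S_def by (auto simp: T_def)
  have finS: "emeasure lborel S < \<infinity>"
    by (rule emeasure_bounded_finite[OF bounded_subset[OF \<Omega>(1) S(2)]])
  have mS: "measure lborel S > 0"
    using p(2)[of "\<rho> / 2"] \<rho>(1) finS unfolding S_def by (simp add: measure_def enn2real_positive_iff)
  have Sx: "0 < \<phi> x \<and> \<phi> x < A \<and> 1 / 2 \<le> b x" if "x \<in> S" for x
    using that tent_ge_half[OF \<rho>(1), of x p] by (auto simp: S_def T_def b_def)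
  define u where "u = (\<lambda>t x. t * \<phi> x + (1 - \<bar>t\<bar>) * b x)"
  have uH: "u t \<in> H_space \<Omega>" for t unfolding u_def by (rule H_space_lincomb[OF \<phi>'(1) bH])
  have pos: "L2_form (u t) (u t) > 0" if t: "t \<in> {-1..1}" for t
  proof (cases "t = 0")
    case True
    have "(1 / 2)\<^sup>2 * measure lborel S \<le> L2_form b b"
    proof (rule order_trans[OF positive_part_lower_bound(1)[OF bH \<Omega>(2) S finS]])
      show "(LINT x:\<Omega>|lborel. (max (b x) 0)\<^sup>2) \<le> L2_form b b"
        by (rule positive_part_lower_bound(2)[OF bH \<Omega>(2) S finS, of "1 / 2"]) (use Sx in auto)
    qed (use Sx in auto)
    moreover have "(1 / 2)\<^sup>2 * measure lborel S > 0" using mS by simp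
    ultimately have "L2_form b b > 0" by linarith
    then show ?thesis using True by (simp add: u_def)
  next
    case False
    show ?thesis
    proof (rule ccontr)
      assume "\<not> L2_form (u t) (u t) > 0"
      then have "L2_form (u t) (u t) = 0" using L2_form_self_nonneg[of "u t"] by simp
      \<comment> \<open>The path avoids 0: off the support of the tent it is t times a positive function.\<close>
      from L2_form_eq_0_AE[OF uH this] \<phi>'(3)
      have "AE x in lborel. x \<in> \<Omega> \<longrightarrow> x \<in> ball p \<rho>"
      proof eventually_elim
        case (elim x)
        then show ?case using False tent_outside[OF \<rho>(1), of x p]
          by (cases "x \<in> ball p \<rho>") (auto simp: u_def b_def)
      qed
      then have "emeasure lborel \<Omega> \<le> emeasure lborel (ball p \<rho>)"
        by (intro emeasure_mono_AE) auto
      then have "measure lborel \<Omega> \<le> measure lborel (ball p \<rho>)"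
        unfolding measure_def using emeasure_lborel_ball_finite[of p \<rho>] by (intro enn2real_mono) auto
      then show False using \<rho>(4) \<eta>(4) by simp
    qed
  qed
  define \<gamma> where "\<gamma> = (\<lambda>t x. 1 / sqrt (L2_form (u t) (u t)) * u t x)"
  have adm: "\<gamma> \<in> admissible_paths \<Omega> \<phi>"
    unfolding \<gamma>_def u_def
    by (rule normalised_path_admissible[OF \<phi>'(1,2) bH]) (use pos in \<open>simp add: u_def\<close>)
  define r\<^sub>0 where "r\<^sub>0 = max 0 (16 * q / measure lborel S)"
  have "E_functional \<Omega> r (\<gamma> t) \<le> first_eigenvalue \<Omega> + \<epsilon>" if r: "r \<ge> r\<^sub>0" and t: "t \<in> {-1..1}" for r t
  proof -
    have "r \<ge> 0" "16 * q \<le> r * measure lborel S" using r mS by (auto simp: r\<^sub>0_def field_simps)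
    then have "E_functional \<Omega> r (u t) \<le> (first_eigenvalue \<Omega> + \<epsilon>) * L2_form (u t) (u t)"
      unfolding u_def using low_level_estimate[OF \<Omega>(1,2) \<phi> bH t S Sx A small1, of \<epsilon> r] small2
      by (simp add: q_def)
    moreover have "E_functional \<Omega> r (\<gamma> t) = E_functional \<Omega> r (u t) / L2_form (u t) (u t)"
      unfolding \<gamma>_def using pos[OF t] by (subst E_functional_scale[OF \<Omega>(1,2) uH]) (auto simp: power_divide)
    ultimately show ?thesis using pos[OF t] by (simp add: divide_le_eq)
  qed
  then show ?thesis using that adm by blast
qed

section \<open>The lower bound along every path\<close>

text \<open>
  The parallelogram identity, with the other diagonal dropped.
\<close>
lemma E_form_le_near:
  assumes "u \<in> H_space \<Omega>" "v \<in> H_space \<Omega>" "H_norm (\<lambda>x. u x - v x) < 1"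
  shows "E_form u u \<le> 2 * E_form v v + 2"
proof -
  define w where "w = (\<lambda>x. u x - v x)"
  have wH: "w \<in> H_space \<Omega>" using H_space_lincomb[OF assms(1,2), of 1 "-1"] by (simp add: w_def)
  have "E_form w w < 1" using assms(3) by (simp add: H_norm_def w_def real_sqrt_lt_1_iff)
  moreover have "E_form u u = E_form v v + 2 * E_form v w + E_form w w"
    using E_form_lincomb[OF assms(2) wH, of 1 1] by (simp add: w_def)
  moreover have "0 \<le> E_form v v - 2 * E_form v w + E_form w w"
    using E_form_lincomb[OF assms(2) wH, of 1 "-1"] E_form_self_nonneg[of "\<lambda>x. 1 * v x + (-1) * w x"] by simp
  ultimately show ?thesis by linarith
qed

text \<open>
  Local boundedness comes from \<open>E_form_le_near\<close>, and compactness of the parameter interval makes it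
  global.
\<close>
lemma E_form_bounded_on_path:
  assumes "\<gamma> \<in> admissible_paths \<Omega> \<phi>"
  obtains M where "\<And>t. t \<in> {-1..1} \<Longrightarrow> E_form (\<gamma> t) (\<gamma> t) \<le> M"
proof -
  have H: "\<gamma> t \<in> H_space \<Omega>" if "t \<in> {-1..1}" for t
    using assms that by (auto simp: admissible_paths_def L2_sphere_iff)
  have "\<exists>V. open V \<and> t \<in> V \<and> (\<forall>s\<in>V \<inter> {-1..1}. E_form (\<gamma> s) (\<gamma> s) \<le> 2 * E_form (\<gamma> t) (\<gamma> t) + 2)"
    if t: "t \<in> {-1..1}" for t
  proof -
    have "((\<lambda>s. H_norm (\<lambda>x. \<gamma> s x - \<gamma> t x)) \<longlongrightarrow> 0) (at t within {-1..1})"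
      using assms t by (simp add: admissible_paths_def)
    then have "\<forall>\<^sub>F s in at t within {-1..1}. H_norm (\<lambda>x. \<gamma> s x - \<gamma> t x) < 1"
      by (rule order_tendstoD) simp
    then obtain V where V: "open V" "t \<in> V" "\<And>s. s \<in> V \<Longrightarrow> s \<noteq> t \<Longrightarrow> s \<in> {-1..1} \<Longrightarrow> H_norm (\<lambda>x. \<gamma> s x - \<gamma> t x) < 1"
      unfolding eventually_at_topological by blast
    have "E_form (\<gamma> s) (\<gamma> s) \<le> 2 * E_form (\<gamma> t) (\<gamma> t) + 2" if "s \<in> V \<inter> {-1..1}" for s
    proof (cases "s = t")
      case True then show ?thesis using E_form_self_nonneg[of "\<gamma> t"] by simp
    next
      case False then show ?thesis using V(3) that H t by (intro E_form_le_near[of _ \<Omega>]) auto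
    qed
    then show ?thesis using V by blast
  qed
  then obtain V where V: "\<And>t. t \<in> {-1..1} \<Longrightarrow> open (V t) \<and> t \<in> V t \<and>
      (\<forall>s\<in>V t \<inter> {-1..1}. E_form (\<gamma> s) (\<gamma> s) \<le> 2 * E_form (\<gamma> t) (\<gamma> t) + 2)" by metis
  have "compact {-1..1::real}" by simp
  moreover have "{-1..1} \<subseteq> (\<Union>t\<in>{-1..1}. V t)" using V by blast
  ultimately obtain F where F: "F \<subseteq> {-1..1}" "finite F" "{-1..1} \<subseteq> (\<Union>t\<in>F. V t)"
    using V compactE_image[of "{-1..1}" "{-1..1}" V] by metis
  have "E_form (\<gamma> s) (\<gamma> s) \<le> (\<Sum>t\<in>F. 2 * E_form (\<gamma> t) (\<gamma> t) + 2)" if s: "s \<in> {-1..1}" for s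
  proof -
    obtain t where t: "t \<in> F" "s \<in> V t" using F s by blast
    then have "E_form (\<gamma> s) (\<gamma> s) \<le> 2 * E_form (\<gamma> t) (\<gamma> t) + 2" using V F s by blast
    also have "\<dots> \<le> (\<Sum>t\<in>F. 2 * E_form (\<gamma> t) (\<gamma> t) + 2)"
      by (rule member_le_sum[OF t(1)]) (auto simp: E_form_self_nonneg F(2))
    finally show ?thesis .
  qed
  then show ?thesis using that by blast
qed

text \<open>
  The first point of the path has no positive part, so its value is one of the logarithmic form on
  the sphere. The supremum of a set of reals is an upper bound only if the set is bounded, which is
  where continuity of the path enters.
\<close>
lemma first_eigenvalue_le_path_sup:
  fixes \<Omega> :: "'a::euclidean_space set"
  assumes \<Omega>: "bounded \<Omega>" "open \<Omega>" and \<phi>: "first_eigenfunction \<Omega> \<phi>"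
    and \<gamma>: "\<gamma> \<in> admissible_paths \<Omega> \<phi>" and r: "r \<ge> 0"
  shows "first_eigenvalue \<Omega> \<le> (SUP t\<in>{-1..1}. E_functional \<Omega> r (\<gamma> t))"
proof -
  note \<phi>' = first_eigenfunctionD[OF \<phi>]
  have sphere: "\<gamma> t \<in> L2_sphere \<Omega>" if "t \<in> {-1..1}" for t
    using \<gamma> that by (simp add: admissible_paths_def)
  obtain M where M: "\<And>t. t \<in> {-1..1} \<Longrightarrow> E_form (\<gamma> t) (\<gamma> t) \<le> M"
    using E_form_bounded_on_path[OF \<gamma>] by blast
  define C where "C = c_const TYPE('a) * measure lborel \<Omega> + \<bar>rho_const TYPE('a)\<bar>"
  have C: "EL_form u u \<le> E_form u u + C" if "u \<in> L2_sphere \<Omega>" for u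
    using abs_EL_form_minus_E_form_le[OF \<Omega>, of u] that by (simp add: L2_sphere_iff C_def)
  have le: "E_functional \<Omega> r u \<le> EL_form u u" for u
    unfolding E_functional_def set_lebesgue_integral_def
    using r by (simp add: Bochner_Integration.integral_nonneg)
  have bdd: "bdd_above ((\<lambda>t. E_functional \<Omega> r (\<gamma> t)) ` {-1..1})"
  proof (rule bdd_aboveI2)
    fix t :: real assume t: "t \<in> {-1..1}"
    show "E_functional \<Omega> r (\<gamma> t) \<le> M + C" using le[of "\<gamma> t"] C[OF sphere[OF t]] M[OF t] by linarith
  qed
  have "AE x in lborel. \<gamma> (-1) x = - \<phi> x" using \<gamma> by (simp add: admissible_paths_def)
  then have "AE x in lborel. indicator \<Omega> x *\<^sub>R (max (\<gamma> (-1) x) 0)\<^sup>2 = 0"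
    using \<phi>'(3) by eventually_elim (auto simp: indicator_def max_def)
  then have "(LINT x:\<Omega>|lborel. (max (\<gamma> (-1) x) 0)\<^sup>2) = 0"
    unfolding set_lebesgue_integral_def by (rule integral_eq_zero_AE)
  then have "first_eigenvalue \<Omega> \<le> E_functional \<Omega> r (\<gamma> (-1))"
    using \<phi>'(4,5) sphere[of "-1"] by (simp add: E_functional_def)
  also have "\<dots> \<le> (SUP t\<in>{-1..1}. E_functional \<Omega> r (\<gamma> t))"
    by (rule cSUP_upper[OF _ bdd]) simp
  finally show ?thesis .
qed

theorem proposition5p6:
  fixes \<Omega> :: "(real ^ 'n) set" and \<phi>\<^sub>1 :: "real ^ 'n \<Rightarrow> real"
  assumes "open \<Omega>" and "connected \<Omega>" and "\<Omega> \<noteq> {}" and "bounded \<Omega>"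
    and "C11_boundary \<Omega>"
    and "first_eigenfunction \<Omega> \<phi>\<^sub>1"
  shows "(minimax_level \<Omega> \<phi>\<^sub>1 \<longlongrightarrow> first_eigenvalue \<Omega>) at_top"
proof (rule tendstoI)
  fix \<epsilon> :: real assume "\<epsilon> > 0"
  obtain \<gamma> r\<^sub>0 where \<gamma>: "\<gamma> \<in> admissible_paths \<Omega> \<phi>\<^sub>1"
    "\<And>r t. r \<ge> r\<^sub>0 \<Longrightarrow> t \<in> {-1..1} \<Longrightarrow> E_functional \<Omega> r (\<gamma> t) \<le> first_eigenvalue \<Omega> + \<epsilon> / 2"
    using exists_low_path[OF assms(4,1,3,6), of "\<epsilon> / 2"] \<open>\<epsilon> > 0\<close> by auto
  have "dist (minimax_level \<Omega> \<phi>\<^sub>1 r) (first_eigenvalue \<Omega>) < \<epsilon>" if r: "r \<ge> max 0 r\<^sub>0" for r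
  proof -
    have low: "first_eigenvalue \<Omega> \<le> (SUP t\<in>{-1..1}. E_functional \<Omega> r (\<gamma> t))"
      if "\<gamma> \<in> admissible_paths \<Omega> \<phi>\<^sub>1" for \<gamma>
      using first_eigenvalue_le_path_sup[OF assms(4,1,6) that] r by simp
    then have "first_eigenvalue \<Omega> \<le> minimax_level \<Omega> \<phi>\<^sub>1 r"
      unfolding minimax_level_def using \<gamma>(1) by (intro cINF_greatest) auto
    moreover have "minimax_level \<Omega> \<phi>\<^sub>1 r \<le> (SUP t\<in>{-1..1}. E_functional \<Omega> r (\<gamma> t))"
      unfolding minimax_level_def using low by (intro cINF_lower[OF bdd_belowI2 \<gamma>(1)]) auto
    moreover have "(SUP t\<in>{-1..1}. E_functional \<Omega> r (\<gamma> t)) \<le> first_eigenvalue \<Omega> + \<epsilon> / 2"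
      using \<gamma>(2) r by (intro cSUP_least) auto
    ultimately show ?thesis using \<open>\<epsilon> > 0\<close> by (simp add: dist_real_def)
  qed
  then show "\<forall>\<^sub>F r in at_top. dist (minimax_level \<Omega> \<phi>\<^sub>1 r) (first_eigenvalue \<Omega>) < \<epsilon>"
    unfolding eventually_at_top_linorder by blast
qed

end
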